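(* Let $\chi_1$ and $\chi_2$ be nontrivial primitive Dirichlet characters modulo $q_1$ and $q_2$ with $\chi_1\chi_2(-1)=1$, let $c$ be a positive integer with $q_1q_2\mid c$, and let $\xi$ be a Dirichlet character modulo $c$. Then \[\sum_{\substack{a\bmod c\\(a,c)=1}}S_{\chi_1,\chi_2}(a,c)\xi(a)=\frac{\varphi(c)}{(\pi i)^2}\cdot\begin{cases}L(1,(\xi\chi_2)^\star)\,L(1,\overline{\xi}^\star\chi_1)\,g_{\chi_1,\chi_2}(\xi;c)&\text{if }\xi\chi_1(-1)=-1,\\0&\text{if }\xi\chi_1(-1)=1,\end{cases}\] where \[g_{\chi_1,\chi_2}(\xi;c)=\tau\big((\overline{\xi\chi_2})^\star\big)\,\tau(\xi^\star)\,\tau(\overline{\chi_1})\sum_{\substack{d\mid c\\ q(\xi)\mid d}}\frac{\overline{\chi_2}(c/d)}{\varphi(d)}\Big(\sum_{k\mid d}\mu(k)(\overline{\xi\chi_2})^\star(k)\Big)\Big(\sum_{k\mid d/q(\xi)}\chi_1(k)\,\mu\!\Big(\frac{d}{kq(\xi)}\Big)\xi^\star\!\Big(\frac{d}{kq(\xi)}\Big)\Big).\]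
   Context: Dirichlet characters are extended by $0$ to integers not coprime to their modulus. $B_1(x)=0$ if $x\in\mathbb{Z}$ and $B_1(x)=x-\lfloor x\rfloor-\tfrac12$ otherwise. For integers $a$ and $c\ge1$ with $q_1q_2\mid c$, \[S_{\chi_1,\chi_2}(a,c)=\sum_{j\bmod c}\sum_{n\bmod q_1}\overline{\chi_2}(j)\overline{\chi_1}(n)B_1\!\Big(\frac{j}{c}\Big)B_1\!\Big(\frac{n}{q_1}+\frac{aj}{c}\Big).\] For a character $\chi$, $\chi^\star$ denotes the primitive character inducing $\chi$ and $q(\chi)$ its conductor. For a character $\chi$ modulo $q$, $\tau(\chi)=\sum_{n\bmod q}\chi(n)e(n/q)$ with $e(x)=\exp(2\pi ix)$ (for $\chi^\star$ taken modulo $q(\chi)$). $\overline{\xi}^\star\chi_1$ is the character $n\mapsto\overline{\xi^\star}(n)\chi_1(n)$; $(\xi\chi_2)^\star$ is the primitive character inducing $n\mapsto\xi(n)\chi_2(n)$ and $(\overline{\xi\chi_2})^\star$ its conjugate. $L(1,\eta)=\sum_{n\ge1}\eta(n)/n$; $\mu$ is the Möbius function and $\varphi$ Euler's function. *)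

theory Defs
  imports
    Complex_Main
    "HOL-Number_Theory.Totient"
    "HOL-Computational_Algebra.Squarefree"
begin

text \<open>
  Characters are total functions on the integers, extended by zero; the modulus is always a
  separate argument. In particular the only character modulo 1 is constantly 1, also at 0.
\<close>

definition dirichlet_char :: "nat \<Rightarrow> (int \<Rightarrow> complex) \<Rightarrow> bool" where
  "dirichlet_char q chi \<longleftrightarrow>
     q > 0 \<and>
     (\<forall>m n. chi (m * n) = chi m * chi n) \<and>
     (\<forall>n. chi (n + int q) = chi n) \<and>
     (\<forall>n. chi n = 0 \<longleftrightarrow> \<not> coprime n (int q))"

definition nontrivial_char :: "nat \<Rightarrow> (int \<Rightarrow> complex) \<Rightarrow> bool" where
  "nontrivial_char q chi \<longleftrightarrow> (\<exists>n. coprime n (int q) \<and> chi n \<noteq> 1)"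

text \<open>The character \<open>\<psi>\<close> modulo \<open>d\<close> induces the character \<open>chi\<close> modulo \<open>q\<close>.\<close>

definition induces :: "nat \<Rightarrow> (int \<Rightarrow> complex) \<Rightarrow> nat \<Rightarrow> (int \<Rightarrow> complex) \<Rightarrow> bool" where
  "induces d \<psi> q chi \<longleftrightarrow>
     dirichlet_char d \<psi> \<and> d dvd q \<and> (\<forall>n. coprime n (int q) \<longrightarrow> chi n = \<psi> n)"

definition primitive_char :: "nat \<Rightarrow> (int \<Rightarrow> complex) \<Rightarrow> bool" where
  "primitive_char q chi \<longleftrightarrow> dirichlet_char q chi \<and> (\<nexists>d \<psi>. d < q \<and> induces d \<psi> q chi)"

definition conductor :: "nat \<Rightarrow> (int \<Rightarrow> complex) \<Rightarrow> nat" where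
  "conductor q chi = (LEAST d. \<exists>\<psi>. induces d \<psi> q chi)"

text \<open>
  The primitive character inducing \<open>chi\<close>, itself a character modulo \<open>conductor q chi\<close>; it exists and
  is unique by \<open>star_char_ex1\<close> below.
\<close>

definition star_char :: "nat \<Rightarrow> (int \<Rightarrow> complex) \<Rightarrow> int \<Rightarrow> complex" where
  "star_char q chi =
     (THE \<psi>. primitive_char (conductor q chi) \<psi> \<and> induces (conductor q chi) \<psi> q chi)"

definition gauss_sum :: "nat \<Rightarrow> (int \<Rightarrow> complex) \<Rightarrow> complex" where
  "gauss_sum q chi =
     (\<Sum>n = 0..<int q. chi n * exp (2 * complex_of_real pi * \<i> * of_int n / of_nat q))"

text \<open>The series is only conditionally convergent; \<open>suminf\<close> is the limit of its partial sums.\<close>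

definition L_one :: "(int \<Rightarrow> complex) \<Rightarrow> complex" where
  "L_one \<eta> = (\<Sum>n. \<eta> (int (Suc n)) / of_nat (Suc n))"

definition moebius :: "nat \<Rightarrow> int" where
  "moebius n = (if squarefree n then (- 1) ^ card (prime_factors n) else 0)"

definition B1 :: "real \<Rightarrow> real" where
  "B1 x = (if x \<in> \<int> then 0 else x - of_int \<lfloor>x\<rfloor> - 1 / 2)"

definition dedekind_S ::
    "nat \<Rightarrow> (int \<Rightarrow> complex) \<Rightarrow> (int \<Rightarrow> complex) \<Rightarrow> int \<Rightarrow> nat \<Rightarrow> complex" where
  "dedekind_S q1 chi1 chi2 a c =
     (\<Sum>j = 0..<int c. \<Sum>n = 0..<int q1.
        cnj (chi2 j) * cnj (chi1 n) *
        complex_of_real (B1 (of_int j / of_nat c)) *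
        complex_of_real (B1 (of_int n / of_nat q1 + of_int (a * j) / of_nat c)))"

definition g_factor ::
    "nat \<Rightarrow> (int \<Rightarrow> complex) \<Rightarrow> (int \<Rightarrow> complex) \<Rightarrow> (int \<Rightarrow> complex) \<Rightarrow> nat \<Rightarrow> complex" where
  "g_factor q1 chi1 chi2 \<xi> c =
     (let q\<xi> = conductor c \<xi>;
          \<xi>s = star_char c \<xi>;
          \<eta> = (\<lambda>n. \<xi> n * chi2 n);
          \<rho> = (\<lambda>n. cnj (star_char c \<eta> n))
      in gauss_sum (conductor c \<eta>) \<rho> * gauss_sum q\<xi> \<xi>s * gauss_sum q1 (\<lambda>n. cnj (chi1 n)) *
         (\<Sum>d | d dvd c \<and> q\<xi> dvd d.
            cnj (chi2 (int (c div d))) / of_nat (totient d) *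
            (\<Sum>k | k dvd d. of_int (moebius k) * \<rho> (int k)) *
            (\<Sum>k | k dvd d div q\<xi>.
               chi1 (int k) * of_int (moebius (d div (k * q\<xi>))) * \<xi>s (int (d div (k * q\<xi>))))))"


lemma dirichlet_char_period_mult:
  assumes "dirichlet_char q chi"
  shows "chi (n + int m * int q) = chi n"
proof (induction m)
  case (Suc m)
  have "chi (n + int (Suc m) * int q) = chi ((n + int m * int q) + int q)"
    by (simp add: algebra_simps)
  also have "\<dots> = chi n"
    using Suc assms by (simp add: dirichlet_char_def)
  finally show ?case .
qed simp

lemma ex_coprime_shift:
  fixes n :: int and d q :: nat
  assumes "q > 0" "coprime n (int d)"
  shows "\<exists>m::nat. coprime (n + int m * int d) (int q)"
proof -
  define P where "P = {p \<in> prime_factors q. \<not> int p dvd n}"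
  define m where "m = \<Prod>P"
  have fin: "finite P" by (simp add: P_def)
  have "coprime (n + int m * int d) (int q)"
  proof (rule ccontr)
    assume "\<not> coprime (n + int m * int d) (int q)"
    then have "gcd (n + int m * int d) (int q) \<noteq> 1" by (simp add: coprime_iff_gcd_eq_1)
    then have "nat (gcd (n + int m * int d) (int q)) \<noteq> 1"
      by (metis gcd_ge_0_int int_nat_eq of_nat_1)
    then obtain p where p: "prime p" "p dvd nat (gcd (n + int m * int d) (int q))"
      using prime_factor_nat by blast
    then have "int p dvd gcd (n + int m * int d) (int q)"
      by (metis gcd_ge_0_int int_dvd_int_iff int_nat_eq)
    then have p1: "int p dvd n + int m * int d" and p2: "p dvd q" by auto
    have pf: "p \<in> prime_factors q" using p(1) p2 assms(1) by (auto simp: prime_factors_dvd)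
    show False
    proof (cases "int p dvd n")
      case False
      then have "p dvd m" using pf fin by (auto simp: P_def m_def)
      then have "int p dvd n"
        using p1 by (metis dvd_add_left_iff dvd_mult2 int_dvd_int_iff)
      then show False using False by simp
    next
      case True
      then have "int p dvd int m * int d" using p1 by (simp add: dvd_add_right_iff)
      then have "p dvd m * d" by (metis int_dvd_int_iff of_nat_mult)
      moreover have "\<not> p dvd d"
      proof
        assume "p dvd d"
        then have "int p dvd int d" by simp
        then have "is_unit (int p)" using True assms(2) coprime_common_divisor by blast
        then show False using p(1) by auto
      qed
      ultimately have "p dvd m" using p(1) by (simp add: prime_dvd_mult_iff)
      then obtain r where r: "r \<in> P" "p dvd r"
        using fin p(1) by (auto simp: m_def prime_dvd_prod_iff)
      then have "r = p" using p(1) primes_dvd_imp_eq by (auto simp: P_def)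
      then show False using r(1) True by (simp add: P_def)
    qed
  qed
  then show ?thesis ..
qed

lemma induces_unique:
  assumes "q > 0" "induces d \<psi> q chi" "induces d \<psi>' q chi"
  shows "\<psi> = \<psi>'"
proof
  fix n
  have ch: "dirichlet_char d \<psi>" "dirichlet_char d \<psi>'" using assms by (auto simp: induces_def)
  show "\<psi> n = \<psi>' n"
  proof (cases "coprime n (int d)")
    case True
    then obtain m where "coprime (n + int m * int d) (int q)"
      using ex_coprime_shift assms(1) by blast
    then have "\<psi> (n + int m * int d) = \<psi>' (n + int m * int d)"
      using assms by (metis induces_def)
    then show ?thesis using ch by (simp add: dirichlet_char_period_mult)
  next
    case False
    then have "\<psi> n = 0" "\<psi>' n = 0" using ch by (auto simp: dirichlet_char_def)
    then show ?thesis by simp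
  qed
qed

lemma star_char_ex1:
  assumes "dirichlet_char q chi"
  shows "\<exists>!\<psi>. primitive_char (conductor q chi) \<psi> \<and> induces (conductor q chi) \<psi> q chi"
proof -
  have q: "q > 0" using assms by (simp add: dirichlet_char_def)
  have "induces q chi q chi" using assms by (simp add: induces_def)
  then have "\<exists>d \<psi>. induces d \<psi> q chi" by blast
  then have "\<exists>\<psi>. induces (conductor q chi) \<psi> q chi"
    unfolding conductor_def by (rule LeastI_ex)
  then obtain \<psi> where \<psi>: "induces (conductor q chi) \<psi> q chi" ..
  have "primitive_char (conductor q chi) \<psi>"
    unfolding primitive_char_def
  proof (intro conjI notI)
    show "dirichlet_char (conductor q chi) \<psi>" using \<psi> by (simp add: induces_def)
    assume "\<exists>d \<psi>'. d < conductor q chi \<and> induces d \<psi>' (conductor q chi) \<psi>"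
    then obtain d \<psi>' where d: "d < conductor q chi" "induces d \<psi>' (conductor q chi) \<psi>" by blast
    have "induces d \<psi>' q chi"
      unfolding induces_def
    proof (intro conjI allI impI)
      show "dirichlet_char d \<psi>'" using d by (simp add: induces_def)
      show "d dvd q" using d \<psi> by (meson dvd_trans induces_def)
      fix n assume n: "coprime n (int q)"
      then have "coprime n (int (conductor q chi))"
        using \<psi> by (meson coprime_divisors dvd_refl induces_def int_dvd_int_iff)
      then show "chi n = \<psi>' n" using n d \<psi> by (simp add: induces_def)
    qed
    then show False using d(1) not_less_Least[of d "\<lambda>d. \<exists>\<psi>. induces d \<psi> q chi"]
      by (auto simp: conductor_def)
  qed
  then show ?thesis using \<psi> induces_unique[OF q] by blast
qed

end

theory Submission
  imports Defs "HOL-Number_Theory.Residues"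
begin

text \<open>
  Write \<open>U d\<close> for the reduced residues modulo \<open>d\<close> and
  \<open>Y y = (\<Sum>n<q1. cnj (chi1 n) * B1 (n / q1 + y))\<close>, a function of period 1. Splitting the
  summation variable of the Dedekind sum as \<open>j = (c / d) b\<close> with \<open>b \<in> U d\<close>, the sum over \<open>a\<close>
  becomes \<open>\<Sum>a\<in>U c. \<xi> a * Y (a b / d)\<close>, which vanishes unless the conductor of \<open>\<xi>\<close> divides
  \<open>d\<close> and otherwise collapses to a sum over \<open>U d\<close>. So the left-hand side is a sum over \<open>d\<close> of
  products of two twisted sums of \<open>B1\<close> over \<open>U d\<close>. Moebius inversion of the coprimality condition,
  the distribution relation of \<open>B1\<close> and the separability of sums against primitive characters
  reduce these to complete sums that no longer depend on \<open>d\<close>, and the Fourier series of \<open>B1\<close>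
  evaluates the latter as Gauss sums times values of \<open>L(1, \<cdot>)\<close>.
\<close>

section \<open>The sawtooth function\<close>

text \<open>Dirichlet kernel: the factor \<open>2 * sin y\<close> turns the k-th cosine into
  \<open>sin ((2 k + 1) y) - sin ((2 k - 1) y)\<close>, and these differences telescope.\<close>

lemma sum_cos_telescope:
  "2 * sin y * (\<Sum>k=1..n. cos (2 * real k * y)) = sin ((2 * real n + 1) * y) - sin y"
proof (induction n)
  case (Suc n)
  have "sin ((2 * real (Suc n) + 1) * y) - sin ((2 * real n + 1) * y)
      = sin (2 * real (Suc n) * y + y) - sin (2 * real (Suc n) * y - y)"
    by (simp add: algebra_simps)
  also have "\<dots> = 2 * sin y * cos (2 * real (Suc n) * y)"
    by (simp add: sin_add sin_diff)
  finally show ?case using Suc by (simp add: distrib_left)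
qed simp

text \<open>
  The sum \<open>\<Sum>k\<le>n. sin (2 pi k x) / k + pi (x - 1/2)\<close> has derivative
  \<open>pi sin ((2 n + 1) pi x) / sin (pi x)\<close>. The last term below cancels this derivative up to
  \<open>O(1/n)\<close> and, like the rest, vanishes at \<open>1/2\<close>, so the mean value theorem applies.
\<close>

lemma sawtooth_bound:
  fixes x :: real
  assumes "0 < x" "x < 1 / 2"
  shows "\<bar>(\<Sum>k=1..n. sin (2 * pi * real k * x) / real k) + pi * (x - 1 / 2)
            + cos ((2 * real n + 1) * (pi * x)) / ((2 * real n + 1) * sin (pi * x))\<bar>
          \<le> pi / ((sin (pi * x))\<^sup>2 * (2 * real n + 1))"
proof -
  define m where "m = 2 * real n + 1"
  have m: "m > 0" by (simp add: m_def)
  define h where "h t = (\<Sum>k=1..n. sin (2 * pi * real k * t) / real k) + pi * (t - 1 / 2)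
            + cos (m * (pi * t)) / (m * sin (pi * t))" for t
  define h' where "h' t = - (pi * cos (pi * t) * cos (m * (pi * t)) / (m * (sin (pi * t))\<^sup>2))" for t
  have sin_pos: "sin (pi * t) \<ge> sin (pi * x)" "sin (pi * t) > 0" if "x \<le> t" "t \<le> 1 / 2" for t
  proof -
    have "pi * x > 0" "pi * x < pi" using assms by auto
    then have "sin (pi * x) > 0" by (rule sin_gt_zero)
    moreover show "sin (pi * t) \<ge> sin (pi * x)"
    proof (rule sin_monotone_2pi_le)
      have "0 < pi * x" using assms by simp
      then show "- (pi / 2) \<le> pi * x" using pi_gt_zero by linarith
    qed (use that pi_gt_zero in \<open>auto simp: field_simps\<close>)
    ultimately show "sin (pi * t) > 0" by linarith
  qed
  have deriv: "DERIV h t :> h' t" if t: "x \<le> t" "t \<le> 1 / 2" for t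
  proof -
    let ?s = "sin (pi * t)"
    have s: "?s > 0" using sin_pos t by blast
    have d: "DERIV h t :> (\<Sum>k=1..n. cos (2 * pi * real k * t) * (2 * pi * real k) / real k) + pi
       + ((- sin (m * (pi * t)) * (m * pi)) * (m * ?s) - cos (m * (pi * t)) * (m * (cos (pi * t) * pi)))
         / ((m * ?s) * (m * ?s))"
      unfolding h_def using m s by (auto intro!: derivative_eq_intros simp: mult_ac)
    have "2 * ?s * (\<Sum>k=1..n. cos (2 * pi * real k * t)) = sin (m * (pi * t)) - ?s"
      using sum_cos_telescope[of "pi * t" n] by (simp add: m_def mult_ac)
    then have c: "(\<Sum>k=1..n. cos (2 * pi * real k * t)) = (sin (m * (pi * t)) - ?s) / (2 * ?s)"
      using s by (simp add: field_simps)
    have "(\<Sum>k=1..n. cos (2 * pi * real k * t) * (2 * pi * real k) / real k)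
        = 2 * pi * (\<Sum>k=1..n. cos (2 * pi * real k * t))"
      unfolding sum_distrib_left by (intro sum.cong) auto
    also have "\<dots> = pi * (sin (m * (pi * t)) - ?s) / ?s"
      unfolding c using s by (simp add: field_simps)
    finally have c': "(\<Sum>k=1..n. cos (2 * pi * real k * t) * (2 * pi * real k) / real k)
      = pi * (sin (m * (pi * t)) - ?s) / ?s" .
    \<comment> \<open>The \<open>- pi\<close> hidden in \<open>c'\<close> cancels the derivative of
      the linear term, and the quotient of sines cancels the part coming from the numerator of the
      cosine term. Only a term with \<open>m\<close> in the denominator survives.\<close>
    show ?thesis
      using d unfolding c' h'_def using s m
      by (simp add: field_simps power2_eq_square)
  qed
  obtain z where z: "x < z" "z < 1 / 2" "h (1 / 2) - h x = (1 / 2 - x) * h' z"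
    using MVT2[of x "1/2" h h'] deriv assms by auto
  \<comment> \<open>The cosine term vanishes because \<open>m\<close> is odd, so that its argument
    is an odd multiple of \<open>pi / 2\<close>.\<close>
  have "h (1 / 2) = 0"
  proof -
    have "sin (2 * pi * real k * (1 / 2)) = 0" for k by (simp add: sin_npi2 mult.commute)
    moreover have "cos (m * (pi * (1 / 2))) = 0"
    proof -
      have "m * (pi * (1 / 2)) = real n * pi + pi / 2" by (simp add: m_def field_simps)
      then show ?thesis by (simp add: cos_add del: distrib_right_numeral)
    qed
    ultimately show ?thesis unfolding h_def by simp
  qed
  then have hx: "\<bar>h x\<bar> = (1 / 2 - x) * \<bar>h' z\<bar>"
    using z(3) assms by (metis abs_minus_commute abs_mult abs_of_pos diff_0 diff_gt_0_iff_gt abs_minus_cancel)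
  have sx: "sin (pi * x) > 0" using sin_pos[of x] assms by simp
  have sz: "sin (pi * z) \<ge> sin (pi * x)" using sin_pos[of z] z by simp
  have "\<bar>h' z\<bar> = pi * \<bar>cos (pi * z)\<bar> * \<bar>cos (m * (pi * z))\<bar> / (m * (sin (pi * z))\<^sup>2)"
    using m by (simp add: h'_def abs_mult)
  \<comment> \<open>The sine increases up to \<open>pi / 2\<close>, so the unknown point
    \<open>z\<close> can be replaced by \<open>x\<close> in the denominator.\<close>
  also have "\<dots> \<le> pi * 1 * 1 / (m * (sin (pi * x))\<^sup>2)"
    using sx sz m by (intro frac_le mult_mono power_mono) auto
  finally have "\<bar>h' z\<bar> \<le> pi / (m * (sin (pi * x))\<^sup>2)" by simp
  moreover have "(1 / 2 - x) * \<bar>h' z\<bar> \<le> 1 * \<bar>h' z\<bar>"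
    using assms by (intro mult_right_mono) auto
  ultimately have "\<bar>h x\<bar> \<le> pi / (m * (sin (pi * x))\<^sup>2)" using hx by linarith
  then show ?thesis unfolding h_def m_def by (simp add: mult.commute)
qed

text \<open>For fixed \<open>x\<close>, both the cosine term and the bound in
  \<open>sawtooth_bound\<close> are O(1 / (2 n + 1)).\<close>

lemma sawtooth_sums_half:
  fixes x :: real
  assumes "0 < x" "x < 1 / 2"
  shows "(\<lambda>k. sin (2 * pi * real (Suc k) * x) / real (Suc k)) sums (- (pi * (x - 1 / 2)))"
proof -
  define s where "s = sin (pi * x)"
  define f where "f n = (\<Sum>k=1..n. sin (2 * pi * real k * x) / real k)" for n
  have "pi * x > 0" "pi * x < pi" using assms by auto
  then have s: "s > 0" unfolding s_def by (rule sin_gt_zero)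
  have bound: "\<bar>f n + pi * (x - 1 / 2)\<bar> \<le> (pi / s\<^sup>2 + 1 / s) * (1 / (2 * real n + 1))" for n
  proof -
    have "\<bar>cos ((2 * real n + 1) * (pi * x)) / ((2 * real n + 1) * s)\<bar>
        = \<bar>cos ((2 * real n + 1) * (pi * x))\<bar> / ((2 * real n + 1) * s)"
      using s by (simp add: abs_mult)
    also have "\<dots> \<le> 1 / ((2 * real n + 1) * s)"
      using s by (intro divide_right_mono) auto
    finally have "\<bar>f n + pi * (x - 1 / 2)\<bar> \<le> pi / (s\<^sup>2 * (2 * real n + 1)) + 1 / ((2 * real n + 1) * s)"
      using sawtooth_bound[OF assms, of n] unfolding f_def s_def by linarith
    then show ?thesis by (simp add: algebra_simps)
  qed
  have "(\<lambda>n. 1 / (2 * real n + 1)) \<longlonglongrightarrow> 0"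
  proof (rule tendsto_sandwich[of "\<lambda>_. 0" _ _ "\<lambda>n. inverse (real (Suc n))"])
    show "(\<lambda>n. inverse (real (Suc n))) \<longlonglongrightarrow> 0" by (rule LIMSEQ_inverse_real_of_nat)
  qed (auto simp: field_simps)
  then have "(\<lambda>n. f n + pi * (x - 1 / 2)) \<longlonglongrightarrow> 0"
  proof (rule tendsto_0_le[where K = "pi / s\<^sup>2 + 1 / s"])
    show "\<forall>\<^sub>F n in sequentially. norm (f n + pi * (x - 1 / 2))
        \<le> norm (1 / (2 * real n + 1)) * (pi / s\<^sup>2 + 1 / s)"
      using bound by (intro always_eventually) (simp add: mult.commute)
  qed
  then have "(\<lambda>n. f n + pi * (x - 1 / 2) - pi * (x - 1 / 2)) \<longlonglongrightarrow> 0 - pi * (x - 1 / 2)"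
    by (intro tendsto_diff tendsto_const)
  then have "f \<longlonglongrightarrow> - (pi * (x - 1 / 2))" by simp
  moreover have "f = (\<lambda>n. \<Sum>k<n. sin (2 * pi * real (Suc k) * x) / real (Suc k))"
    unfolding f_def by (intro ext sum.reindex_bij_witness[of _ Suc "\<lambda>k. k - 1"]) auto
  ultimately show ?thesis by (simp only: sums_def)
qed

section \<open>Periodicity, Fourier series and distribution relation of \<open>B1\<close>\<close>

lemma B1_frac: "B1 x = (if frac x = 0 then 0 else frac x - 1 / 2)"
  unfolding B1_def frac_eq_0_iff by (simp add: frac_def)

lemma B1_add_int [simp]: "B1 (x + of_int n) = B1 x"
  by (simp add: B1_frac)

lemma B1_minus [simp]: "B1 (- x) = - B1 x"
  using frac_lt_1[of x] by (auto simp: B1_frac frac_neg frac_eq_0_iff)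

text \<open>Both sides have period 1, which leaves \<open>y = frac x\<close>. Beyond 1/2 the
  reflection from \<open>y\<close> to \<open>1 - y\<close> negates both sides; at 0 and 1/2 every
  sine vanishes, and so does \<open>B1\<close>.\<close>

lemma sawtooth_sums:
  "(\<lambda>k. sin (2 * pi * real (Suc k) * x) / real (Suc k)) sums (- (pi * B1 x))"
proof -
  define y where "y = frac x"
  have y: "0 \<le> y" "y < 1" by (auto simp: y_def frac_lt_1)
  have Bx: "B1 x = (if y = 0 then 0 else y - 1 / 2)" by (simp add: B1_frac y_def)
  have xy: "sin (2 * pi * real (Suc k) * x) = sin (2 * pi * real (Suc k) * y)" for k
  proof -
    have "2 * pi * real (Suc k) * x = 2 * pi * real (Suc k) * y + 2 * pi * of_int (int (Suc k) * \<lfloor>x\<rfloor>)"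
      by (simp add: y_def frac_def algebra_simps)
    then show ?thesis
      by (metis cos_int_2pin sin_int_2pin sin_add mult.right_neutral mult_zero_right add.right_neutral)
  qed
  consider "y = 0" | "0 < y" "y < 1 / 2" | "y = 1 / 2" | "1 / 2 < y" "y < 1"
    using y by linarith
  then show ?thesis
  proof cases
    case 1
    then show ?thesis unfolding xy Bx by simp
  next
    case 2
    then show ?thesis unfolding xy Bx using sawtooth_sums_half[of y] by simp
  next
    case 3
    have "sin (2 * pi * real (Suc k) * (1 / 2)) = 0" for k
    proof -
      have "2 * pi * real (Suc k) * (1 / 2) = pi * real (Suc k)" by simp
      then show ?thesis by (simp only: sin_npi2)
    qed
    then show ?thesis unfolding xy Bx 3 by simp
  next
    case 4
    have "sin (2 * pi * real (Suc k) * (1 - y)) = - sin (2 * pi * real (Suc k) * y)" for k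
    proof -
      have "2 * pi * real (Suc k) * (1 - y) = 2 * pi * of_int (int (Suc k)) - 2 * pi * real (Suc k) * y"
        by (simp add: algebra_simps)
      then show ?thesis
        using sin_diff[of "2 * pi * of_int (int (Suc k))" "2 * pi * real (Suc k) * y"]
          cos_int_2pin[of "int (Suc k)"] sin_int_2pin[of "int (Suc k)"] by (metis diff_0 mult_1 mult_zero_left)
    qed
    then show ?thesis unfolding xy Bx
      using sums_minus[OF sawtooth_sums_half[of "1 - y"]] 4 by (simp add: algebra_simps)
  qed
qed

text \<open>Frequencies k and -k are paired into one term of a one-sided series. Exponentials are
  used because they turn sums in the argument into products, which lets double character sums
  factor.\<close>

lemma B1_fourier:
  "(\<lambda>k. (cis (2 * pi * (real (Suc k) * x)) - cis (- (2 * pi * (real (Suc k) * x)))) / of_nat (Suc k))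
     sums (- (2 * pi * \<i> * B1 x))"
proof -
  have "(\<lambda>k. complex_of_real (sin (2 * pi * real (Suc k) * x) / real (Suc k))) sums
      complex_of_real (- (pi * B1 x))"
    by (rule sums_of_real[OF sawtooth_sums])
  then have "(\<lambda>k. 2 * \<i> * complex_of_real (sin (2 * pi * real (Suc k) * x) / real (Suc k))) sums
      (2 * \<i> * complex_of_real (- (pi * B1 x)))"
    by (rule sums_mult)
  moreover have "(cis t - cis (- t)) = 2 * \<i> * complex_of_real (sin t)" for t
    by (simp add: complex_eq_iff)
  ultimately show ?thesis by (simp add: mult_ac)
qed

text \<open>Both sides have period 1 in \<open>z\<close>: raising \<open>z\<close> by 1 shifts
  \<open>t\<close>, and the term at \<open>N\<close> equals the term at 0. For \<open>z\<close> in
  [0, 1) all arguments lie in [0, 1), where \<open>B1\<close> is linear except at 0.\<close>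

lemma B1_distribution:
  assumes "N > 0"
  shows "(\<Sum>t<N. B1 ((z + real t) / real N)) = B1 z"
proof -
  define f where "f z = (\<Sum>t<N. B1 ((z + real t) / real N))" for z
  have step: "f (z + 1) = f z" for z
  proof -
    have "f (z + 1) = (\<Sum>t<N. B1 ((z + real (Suc t)) / real N))"
      unfolding f_def by (intro sum.cong) (auto simp: algebra_simps)
    also have "\<dots> = (\<Sum>t<Suc N. B1 ((z + real t) / real N)) - B1 (z / real N)"
      by (subst sum.lessThan_Suc_shift) simp
    also have "\<dots> = f z + B1 ((z + real N) / real N) - B1 (z / real N)"
      by (simp add: f_def)
    also have "(z + real N) / real N = z / real N + of_int 1"
      using assms by (simp add: field_simps)
    also have "B1 \<dots> = B1 (z / real N)" by (rule B1_add_int)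
    finally show ?thesis by simp
  qed
  have step_nat: "f (z + real n) = f z" for z n
  proof (induction n)
    case (Suc n)
    then show ?case using step[of "z + real n"] by (simp add: add_ac)
  qed simp
  have step_int: "f (z + of_int n) = f z" for z n
  proof (cases "n \<ge> 0")
    case True
    then show ?thesis using step_nat[of z "nat n"] by simp
  next
    case False
    then show ?thesis using step_nat[of "z + of_int n" "nat (- n)"] by simp
  qed
  define y where "y = frac z"
  have y: "0 \<le> y" "y < 1" by (auto simp: y_def frac_lt_1)
  have "z = y + of_int \<lfloor>z\<rfloor>" by (simp add: y_def frac_def)
  then have fz: "f z = f y" by (metis step_int)
  have gauss: "(\<Sum>t<N. real t) = real N * (real N - 1) / 2"
    by (induction N) (auto simp: field_simps)
  \<comment> \<open>The extra 1/2 corrects the only possible integer argument, where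
    \<open>B1\<close> is 0 and not -1/2.\<close>
  have summand: "B1 ((y + real t) / real N) = (y + real t) / real N - 1 / 2 + (if y = 0 \<and> t = 0 then 1 / 2 else 0)"
    if "t < N" for t
  proof -
    have "y + real t < real N" using that y by linarith
    then have "0 \<le> (y + real t) / real N" "(y + real t) / real N < 1"
      using that y assms by auto
    then have fr: "frac ((y + real t) / real N) = (y + real t) / real N" by (simp add: frac_eq)
    show ?thesis using y assms unfolding B1_frac fr by auto
  qed
  have "f y = (\<Sum>t<N. (y + real t) / real N - 1 / 2 + (if y = 0 \<and> t = 0 then 1 / 2 else 0))"
    unfolding f_def by (intro sum.cong refl summand) simp
  also have "\<dots> = y + (real N - 1) / 2 - real N / 2 + (\<Sum>t<N. if y = 0 \<and> t = 0 then 1 / 2 else 0)"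
    using assms by (simp add: sum.distrib sum_subtractf add_divide_distrib gauss flip: sum_divide_distrib)
  also have "(\<Sum>t<N. if y = 0 \<and> t = 0 then 1 / 2 else (0::real)) = (if y = 0 then 1 / 2 else 0)"
    using assms by (auto simp: sum.delta)
  also have "y + (real N - 1) / 2 - real N / 2 + \<dots> = B1 z"
    by (simp add: B1_frac y_def[symmetric] field_simps)
  finally show ?thesis using fz by (simp add: f_def)
qed

section \<open>Dirichlet characters and conductors\<close>

lemma dirichlet_char_mult: "dirichlet_char q chi \<Longrightarrow> chi (m * n) = chi m * chi n"
  by (simp add: dirichlet_char_def)

lemma dirichlet_char_eq_0_iff: "dirichlet_char q chi \<Longrightarrow> chi n = 0 \<longleftrightarrow> \<not> coprime n (int q)"
  by (simp add: dirichlet_char_def)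

lemma dirichlet_char_modulus_pos: "dirichlet_char q chi \<Longrightarrow> q > 0"
  by (simp add: dirichlet_char_def)

lemma dirichlet_char_1:
  assumes "dirichlet_char q chi"
  shows "chi 1 = 1"
proof -
  have "chi 1 * chi 1 = chi 1" using dirichlet_char_mult[OF assms, of 1 1] unfolding mult_1 by (rule sym)
  moreover have "chi 1 \<noteq> 0" using dirichlet_char_eq_0_iff[OF assms, of 1] by simp
  ultimately show ?thesis unfolding mult_cancel_left1 by simp
qed

lemma dirichlet_char_cong:
  assumes "dirichlet_char q chi" "[a = b] (mod int q)"
  shows "chi a = chi b"
proof -
  have shift: "chi (n + k * int q) = chi n" for n k :: int
  proof (cases "k \<ge> 0")
    case True
    then show ?thesis using dirichlet_char_period_mult[OF assms(1), of n "nat k"] by simp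
  next
    case False
    then show ?thesis
      using dirichlet_char_period_mult[OF assms(1), of "n + k * int q" "nat (- k)"] by simp
  qed
  obtain k where "b = a + int q * k" using assms(2) unfolding cong_iff_lin by blast
  then show ?thesis using shift[of a k] by (simp add: mult.commute)
qed

lemma dirichlet_char_power: "dirichlet_char q chi \<Longrightarrow> chi (n ^ k) = chi n ^ k"
  by (induction k) (simp_all add: dirichlet_char_1 dirichlet_char_mult)

text \<open>By Euler's theorem the values at units are roots of unity of order dividing
  \<open>totient q\<close>.\<close>

lemma dirichlet_char_norm:
  assumes "dirichlet_char q chi" "coprime n (int q)"
  shows "norm (chi n) = 1"
proof -
  have q: "q > 0" using assms(1) by (rule dirichlet_char_modulus_pos)
  define m where "m = nat (n mod int q)"
  have m: "int m = n mod int q" using q by (simp add: m_def)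
  have "coprime (int m) (int q)"
    unfolding m using assms(2) q by simp
  then have cm: "coprime m q" unfolding coprime_int_iff .
  then have "[m ^ totient q = 1] (mod q)" by (rule euler_theorem)
  then have "[int m ^ totient q = 1] (mod int q)"
    unfolding cong_int_iff[symmetric] by simp
  then have "chi (int m) ^ totient q = 1"
    using dirichlet_char_cong[OF assms(1), of "int m ^ totient q" 1]
    by (simp add: dirichlet_char_power[OF assms(1)] dirichlet_char_1[OF assms(1)])
  moreover have "chi (int m) = chi n"
    by (rule dirichlet_char_cong[OF assms(1)]) (simp add: m cong_def)
  ultimately have "chi n ^ totient q = 1" by simp
  then have "norm (chi n) ^ totient q = 1" unfolding norm_power[symmetric] by simp
  then show ?thesis
    using power_eq_iff_eq_base[of "totient q" "norm (chi n)" 1] q by simp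
qed

lemma dirichlet_char_mult_cnj:
  assumes "dirichlet_char q chi" "coprime n (int q)"
  shows "chi n * cnj (chi n) = 1"
  using dirichlet_char_norm[OF assms] by (simp add: complex_norm_square[symmetric])

lemma dirichlet_char_minus_1_square:
  assumes "dirichlet_char q chi"
  shows "chi (- 1) * chi (- 1) = 1"
  using dirichlet_char_mult[OF assms, of "-1" "-1"] dirichlet_char_1[OF assms] by simp

lemma dirichlet_char_minus:
  assumes "dirichlet_char q chi"
  shows "chi (- n) = chi (- 1) * chi n"
  using dirichlet_char_mult[OF assms, of "-1" n] by simp

lemma dirichlet_char_cnj:
  "dirichlet_char q chi \<Longrightarrow> dirichlet_char q (\<lambda>n. cnj (chi n))"
  by (simp add: dirichlet_char_def)

lemma primitive_char_imp_dirichlet_char: "primitive_char q chi \<Longrightarrow> dirichlet_char q chi"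
  by (simp add: primitive_char_def)

text \<open>Conjugating a character of smaller modulus that induces the conjugate of
  \<open>chi\<close> would give one that induces \<open>chi\<close>.\<close>

lemma primitive_char_cnj:
  assumes "primitive_char q chi"
  shows "primitive_char q (\<lambda>n. cnj (chi n))"
  unfolding primitive_char_def
proof (intro conjI notI)
  show "dirichlet_char q (\<lambda>n. cnj (chi n))"
    using assms by (intro dirichlet_char_cnj primitive_char_imp_dirichlet_char)
  assume "\<exists>d \<psi>. d < q \<and> induces d \<psi> q (\<lambda>n. cnj (chi n))"
  then obtain d \<psi> where d: "d < q" "induces d \<psi> q (\<lambda>n. cnj (chi n))" by blast
  have "chi n = cnj (\<psi> n)" if "coprime n (int q)" for n
  proof -
    have "\<psi> n = cnj (chi n)" using d(2) that by (simp add: induces_def)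
    then show ?thesis by simp
  qed
  then have "induces d (\<lambda>n. cnj (\<psi> n)) q chi"
    using d(2) by (simp add: induces_def dirichlet_char_cnj)
  then show False using assms d(1) unfolding primitive_char_def by blast
qed

text \<open>Primitive because a smaller modulus would be 0. It serves later as a dummy second
  character.\<close>

lemma primitive_char_trivial: "primitive_char 1 (\<lambda>_. 1)"
  by (auto simp: primitive_char_def dirichlet_char_def induces_def)

section \<open>Sums over complete and reduced residue systems\<close>

abbreviation (input) unit_residues :: "nat \<Rightarrow> int set" where
  "unit_residues n \<equiv> {a \<in> {0..<int n}. coprime a (int n)}"

text \<open>Multiplication by a unit permutes the residues, with multiplication by its inverse
  \<open>s\<close> as the inverse permutation.\<close>

lemma sum_residues_mult:
  fixes F :: "int \<Rightarrow> 'a :: comm_monoid_add"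
  assumes "coprime t (int n)" and "\<And>a b. [a = b] (mod int n) \<Longrightarrow> F a = F b"
  shows "(\<Sum>a = 0..<int n. F (t * a)) = (\<Sum>a = 0..<int n. F a)"
proof (cases "n = 0")
  case False
  obtain s where s: "[t * s = 1] (mod int n)" using assms(1) cong_solve_coprime_int by blast
  have inv: "t * (s * a mod int n) mod int n = a" "s * (t * a mod int n) mod int n = a"
    if "a \<in> {0..<int n}" for a
  proof -
    have "(t * s) * a mod int n = 1 * a mod int n" using s by (metis cong_def mod_mult_left_eq)
    then have "(t * s) * a mod int n = a" using that by simp
    then show "t * (s * a mod int n) mod int n = a" "s * (t * a mod int n) mod int n = a"
      by (simp_all add: mod_mult_right_eq mult_ac)
  qed
  show ?thesis
    by (rule sum.reindex_bij_witness[of _ "\<lambda>a. s * a mod int n" "\<lambda>a. t * a mod int n"])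
       (use False inv in \<open>auto intro!: assms(2) simp: cong_def\<close>)
qed simp

text \<open>Extending \<open>F\<close> by zero to the non-units leads back to complete residue
  systems.\<close>

lemma sum_unit_residues_mult:
  fixes F :: "int \<Rightarrow> 'a :: comm_monoid_add"
  assumes "coprime t (int n)" and "\<And>a b. [a = b] (mod int n) \<Longrightarrow> F a = F b"
  shows "(\<Sum>a\<in>unit_residues n. F (t * a)) = (\<Sum>a\<in>unit_residues n. F a)"
proof -
  define G where "G a = (if coprime a (int n) then F a else 0)" for a
  have "(\<Sum>a\<in>unit_residues n. F (t * a)) = (\<Sum>a = 0..<int n. G (t * a))"
    using assms(1) by (intro sum.mono_neutral_cong_left) (auto simp: G_def)
  also have "\<dots> = (\<Sum>a = 0..<int n. G a)"
  proof (rule sum_residues_mult[OF assms(1)])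
    fix a b assume "[a = b] (mod int n)"
    then show "G a = G b" unfolding G_def using assms(2)[of a b] cong_imp_coprime cong_sym by metis
  qed
  also have "\<dots> = (\<Sum>a\<in>unit_residues n. F a)"
    by (intro sum.mono_neutral_cong_right) (auto simp: G_def)
  finally show ?thesis .
qed

lemma finite_unit_residues: "finite (unit_residues n)"
  by (rule finite_subset[of _ "{0..<int n}"]) auto

lemma card_unit_residues: "n > 0 \<Longrightarrow> card (unit_residues n) = totient n"
\<comment> \<open>\<open>totatives 1\<close> is {1} while the residue system modulo 1 is {0}, so
  this modulus falls outside the bijection below.\<close>
proof (cases "n = 1")
  case True
  have "unit_residues 1 = {0}" by auto
  then show ?thesis using True by simp
next
  case False
  assume "n > 0"
  then have n: "n > 1" using False by simp
  have "bij_betw int (totatives n) (unit_residues n)"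
  proof (rule bij_betw_byWitness[of _ nat])
    show "int ` totatives n \<subseteq> unit_residues n"
      using n by (auto simp: totatives_less in_totatives_iff)
    show "nat ` unit_residues n \<subseteq> totatives n"
    proof clarify
      fix a assume a: "a \<in> {0..<int n}" "coprime a (int n)"
      then have "coprime (nat a) n" using coprime_int_iff[of "nat a" n] by simp
      moreover from this have "nat a \<noteq> 0" using n by (intro notI) simp
      ultimately show "nat a \<in> totatives n" using a by (simp add: in_totatives_iff)
    qed
  qed auto
  then show ?thesis by (metis bij_betw_same_card totient_def)
qed

lemma coprime_lift_residue:
  fixes a :: int
  assumes "c > 0" "coprime a (int d)"
  obtains a' where "[a' = a] (mod int d)" "coprime a' (int c)"
proof -
  obtain m where "coprime (a + int m * int d) (int c)" using ex_coprime_shift assms by blast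
  then show ?thesis by (rule that[rotated]) (simp add: cong_def)
qed

text \<open>Both sides are evaluated as the double sum of \<open>F (t b * a)\<close> over \<open>b\<close> modulo \<open>d\<close> and
  \<open>a\<close> modulo \<open>c\<close>, where \<open>t b\<close> lifts \<open>b\<close> to a unit modulo \<open>c\<close>.\<close>

lemma sum_unit_residues_reduce:
  fixes F :: "int \<Rightarrow> 'a :: comm_semiring_1"
  assumes "c > 0" "d dvd c" and F: "\<And>a b. [a = b] (mod int d) \<Longrightarrow> F a = F b"
  shows "of_nat (totient d) * (\<Sum>a\<in>unit_residues c. F a) =
    of_nat (totient c) * (\<Sum>b\<in>unit_residues d. F b)"
proof -
  have d: "d > 0" using assms by (auto intro: Nat.gr0I)
  have Fc: "F a = F b" if "[a = b] (mod int c)" for a b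
    using F that assms(2) cong_dvd_mono_modulus int_dvd_int_iff by blast
  have "\<exists>t. [t = b] (mod int d) \<and> coprime t (int c)" if "b \<in> unit_residues d" for b
    using coprime_lift_residue[OF assms(1)] that by blast
  then obtain t where t: "\<And>b. b \<in> unit_residues d \<Longrightarrow> [t b = b] (mod int d) \<and> coprime (t b) (int c)"
    by metis
  have "of_nat (totient d) * (\<Sum>a\<in>unit_residues c. F a)
      = (\<Sum>b\<in>unit_residues d. \<Sum>a\<in>unit_residues c. F a)"
    by (simp only: sum_constant card_unit_residues[OF d])
  also have "\<dots> = (\<Sum>b\<in>unit_residues d. \<Sum>a\<in>unit_residues c. F (t b * a))"
  proof (rule sum.cong[OF refl])
    fix b assume "b \<in> unit_residues d"
    then have "coprime (t b) (int c)" using t by blast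
    then show "sum F (unit_residues c) = (\<Sum>a\<in>unit_residues c. F (t b * a))"
      by (rule sum_unit_residues_mult[symmetric]) (rule Fc)
  qed
  also have "\<dots> = (\<Sum>a\<in>unit_residues c. \<Sum>b\<in>unit_residues d. F (a * b))"
  proof (subst sum.swap, intro sum.cong refl F)
    fix a b assume "b \<in> unit_residues d"
    then show "[t b * a = a * b] (mod int d)"
      using t cong_scalar_right[of "t b" b "int d" a] by (simp add: mult.commute)
  qed
  also have "\<dots> = (\<Sum>a\<in>unit_residues c. \<Sum>b\<in>unit_residues d. F b)"
  proof (rule sum.cong[OF refl])
    fix a assume "a \<in> unit_residues c"
    then have "coprime a (int d)" using assms(2) by (auto intro: coprime_divisors[of a a _ "int c"])
    then show "(\<Sum>b\<in>unit_residues d. F (a * b)) = sum F (unit_residues d)"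
      by (rule sum_unit_residues_mult) (rule F)
  qed
  also have "\<dots> = of_nat (totient c) * (\<Sum>b\<in>unit_residues d. F b)"
    by (simp only: sum_constant card_unit_residues[OF assms(1)])
  finally show ?thesis .
qed

section \<open>Conductors and factoring through a smaller modulus\<close>

text \<open>For \<open>d dvd q\<close> this is triviality of \<open>chi\<close> on the kernel of the
  map from units modulo \<open>q\<close> to units modulo \<open>d\<close>. It speaks of
  \<open>chi\<close> alone, so its negation yields two explicit units, and it combines well under
  gcd.\<close>

definition factors_through :: "nat \<Rightarrow> nat \<Rightarrow> (int \<Rightarrow> complex) \<Rightarrow> bool" where
  "factors_through d q chi \<longleftrightarrow>
     (\<forall>a b. coprime a (int q) \<longrightarrow> coprime b (int q) \<longrightarrow> [a = b] (mod int d) \<longrightarrow> chi a = chi b)"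

text \<open>An inducing character is periodic modulo \<open>d\<close>, which gives one direction.
  For the other, \<open>\<psi> n\<close> is taken to be the value of \<open>chi\<close> at a lift of
  \<open>n\<close> to a unit modulo \<open>q\<close>.\<close>

lemma factors_through_iff_induces:
  assumes chi: "dirichlet_char q chi" and dq: "d dvd q"
  shows "factors_through d q chi \<longleftrightarrow> (\<exists>\<psi>. induces d \<psi> q chi)"
proof
  assume "\<exists>\<psi>. induces d \<psi> q chi"
  then obtain \<psi> where \<psi>: "induces d \<psi> q chi" ..
  show "factors_through d q chi"
    unfolding factors_through_def
  proof (intro allI impI)
    fix a b assume "coprime a (int q)" "coprime b (int q)" and ab: "[a = b] (mod int d)"
    then have "chi a = \<psi> a" "chi b = \<psi> b" using \<psi> by (simp_all add: induces_def)
    moreover have "\<psi> a = \<psi> b" using dirichlet_char_cong[OF _ ab] \<psi> by (simp add: induces_def)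
    ultimately show "chi a = chi b" by simp
  qed
next
  assume fac: "factors_through d q chi"
  have q: "q > 0" using chi by (rule dirichlet_char_modulus_pos)
  then have d: "d > 0" using dq by (auto intro: Nat.gr0I)
  have copr: "coprime a (int d)" if "coprime a (int q)" for a
    using that dq by (auto intro: coprime_divisors[of a a _ "int q"])
  have "\<exists>a. coprime n (int d) \<longrightarrow> [a = n] (mod int d) \<and> coprime a (int q)" for n
  proof (cases "coprime n (int d)")
    case True
    then show ?thesis using coprime_lift_residue[OF q] by blast
  qed simp
  then obtain t where t: "\<And>n. coprime n (int d) \<Longrightarrow> [t n = n] (mod int d)"
    "\<And>n. coprime n (int d) \<Longrightarrow> coprime (t n) (int q)"
    by metis
  define \<psi> where "\<psi> n = (if coprime n (int d) then chi (t n) else 0)" for n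
  \<comment> \<open>Independence of the lift; multiplicativity, periodicity and agreement with
    \<open>chi\<close> all come from it.\<close>
  have \<psi>_eq: "\<psi> n = chi a" if "[a = n] (mod int d)" "coprime a (int q)" for a n
  proof -
    have n: "coprime n (int d)" using that copr cong_imp_coprime by blast
    then have "[t n = a] (mod int d)" using t that by (metis cong_trans cong_sym)
    then have "chi (t n) = chi a"
      using fac t(2)[OF n] that(2) unfolding factors_through_def by blast
    then show ?thesis using n by (simp add: \<psi>_def)
  qed
  have "dirichlet_char d \<psi>"
    unfolding dirichlet_char_def
  proof (intro conjI allI)
    fix m n :: int
    show "\<psi> (m * n) = \<psi> m * \<psi> n"
    proof (cases "coprime m (int d) \<and> coprime n (int d)")
      case True
      then have "\<psi> (m * n) = chi (t m * t n)"
        by (intro \<psi>_eq cong_mult) (simp_all add: t)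
      then show ?thesis using True by (simp add: \<psi>_def dirichlet_char_mult[OF chi])
    qed (auto simp: \<psi>_def)
    show "\<psi> (n + int d) = \<psi> n"
    proof (cases "coprime n (int d)")
      case True
      have "[t n = n + int d] (mod int d)" using t(1)[OF True] by (simp add: cong_def)
      then have "\<psi> (n + int d) = chi (t n)" using t(2)[OF True] by (rule \<psi>_eq)
      then show ?thesis using True by (simp add: \<psi>_def)
    next
      case False
      moreover have "\<not> coprime (n + int d) (int d)"
        using False cong_imp_coprime[of "n + int d" n "int d"] by (auto simp: cong_def)
      ultimately show ?thesis by (simp add: \<psi>_def)
    qed
    show "\<psi> n = 0 \<longleftrightarrow> \<not> coprime n (int d)"
      by (simp add: \<psi>_def dirichlet_char_eq_0_iff[OF chi] t(2))
  qed (use d in simp)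
  then have "induces d \<psi> q chi"
    using dq \<psi>_eq[OF cong_refl] by (simp add: induces_def)
  then show "\<exists>\<psi>. induces d \<psi> q chi" by blast
qed

text \<open>Congruence modulo the gcd is the solvability condition for a \<open>v\<close> that is
  \<open>a\<close> modulo \<open>d1\<close> and \<open>b\<close> modulo \<open>d2\<close>. With
  \<open>v\<close> chosen as a unit modulo \<open>q\<close>, the values at \<open>a\<close> and
  \<open>b\<close> both equal \<open>chi v\<close>.\<close>

lemma factors_through_gcd:
  assumes "q > 0" "d1 dvd q" "d2 dvd q" "factors_through d1 q chi" "factors_through d2 q chi"
  shows "factors_through (gcd d1 d2) q chi"
  unfolding factors_through_def
proof (intro allI impI)
  fix a b :: int
  assume a: "coprime a (int q)" and b: "coprime b (int q)"
    and ab: "[a = b] (mod int (gcd d1 d2))"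
  have pos: "d1 > 0" "d2 > 0" using assms by (auto intro: Nat.gr0I)
  have "gcd (int d1) (int d2) dvd b - a"
    using ab by (metis cong_iff_dvd_diff cong_sym gcd_int_int_eq)
  then obtain x where x: "[int d1 * x = b - a] (mod int d2)"
    using cong_solve_dvd_int by blast
  \<comment> \<open>This solves both congruences but need not be a unit modulo \<open>q\<close>. It
    is coprime to the lcm, so it can be lifted to such a unit.\<close>
  define u where "u = a + int d1 * x"
  have u1: "[u = a] (mod int d1)" by (simp add: u_def cong_def)
  have u2: "[u = b] (mod int d2)"
    using cong_add[OF cong_refl[of a "int d2"] x] by (simp add: u_def)
  have "coprime a (int d1)" "coprime b (int d2)"
    using a b assms(2,3) by (auto intro: coprime_divisors[of _ _ _ "int q"])
  then have u: "coprime u (int d1)" "coprime u (int d2)"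
    using u1 u2 by (metis cong_imp_coprime cong_sym)+
  have "coprime u (int (lcm d1 d2))"
  proof (rule coprime_divisors[of u u])
    show "int (lcm d1 d2) dvd int d1 * int d2" unfolding of_nat_mult[symmetric] int_dvd_int_iff by simp
  qed (simp_all add: u)
  then obtain v where v: "[v = u] (mod int (lcm d1 d2))" "coprime v (int q)"
    using coprime_lift_residue[OF assms(1)] by blast
  have "[v = a] (mod int d1)" "[v = b] (mod int d2)"
    using cong_dvd_mono_modulus[OF v(1), of "int d1"] cong_dvd_mono_modulus[OF v(1), of "int d2"] u1 u2
    by (auto intro: cong_trans)
  then have "chi v = chi a" "chi v = chi b"
    using assms(4,5) a b v(2) unfolding factors_through_def by blast+
  then show "chi a = chi b" by simp
qed

lemma star_char:
  assumes "dirichlet_char q chi"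
  shows "primitive_char (conductor q chi) (star_char q chi)"
    and "induces (conductor q chi) (star_char q chi) q chi"
  using theI'[OF star_char_ex1[OF assms]] unfolding star_char_def by blast+

lemma star_char_props:
  assumes "dirichlet_char q chi"
  shows "dirichlet_char (conductor q chi) (star_char q chi)"
    and "conductor q chi dvd q"
    and "coprime n (int q) \<Longrightarrow> chi n = star_char q chi n"
  using star_char(2)[OF assms] by (auto simp: induces_def)

text \<open>The conductor is defined as least in size. Since its gcd with \<open>d\<close> is again
  an inducing modulus, minimality forces that gcd to be the conductor itself.\<close>

lemma conductor_dvd:
  assumes "dirichlet_char q chi" "d dvd q" "factors_through d q chi"
  shows "conductor q chi dvd d"
proof -
  let ?k = "conductor q chi"
  have q: "q > 0" using assms(1) by (rule dirichlet_char_modulus_pos)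
  have k: "?k dvd q" "factors_through ?k q chi"
    using star_char_props(2)[OF assms(1)] star_char(2)[OF assms(1)]
      factors_through_iff_induces[OF assms(1)] by blast+
  have "factors_through (gcd ?k d) q chi" using factors_through_gcd q k assms by blast
  moreover have "gcd ?k d dvd q" using k(1) by (meson dvd_trans gcd_dvd1)
  ultimately have "\<exists>\<psi>. induces (gcd ?k d) \<psi> q chi"
    using factors_through_iff_induces[OF assms(1)] by blast
  then have "?k \<le> gcd ?k d" unfolding conductor_def by (intro Least_le)
  moreover have "?k > 0" using k(1) q by (auto intro: Nat.gr0I)
  ultimately have "gcd ?k d = ?k" by (meson dvd_imp_le gcd_dvd1 le_antisym)
  then show ?thesis by (metis gcd_dvd2)
qed

section \<open>Character sums against periodic functions\<close>

text \<open>There is a unit \<open>t\<close> congruent to 1 modulo \<open>d\<close> with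
  \<open>chi t \<noteq> 1\<close>. Replacing \<open>a\<close> by \<open>t * a\<close> leaves
  \<open>F\<close> unchanged and shows that the sum equals \<open>chi t\<close> times
  itself.\<close>

lemma sum_char_periodic_eq_0:
  assumes chi: "dirichlet_char q chi" and "d dvd q" "\<not> factors_through d q chi"
    and F: "\<And>a b. [a = b] (mod int d) \<Longrightarrow> F a = F b"
  shows "(\<Sum>a = 0..<int q. chi a * F a) = 0"
proof -
  obtain a b where ab: "coprime a (int q)" "coprime b (int q)" "[a = b] (mod int d)" "chi a \<noteq> chi b"
    using assms(3) unfolding factors_through_def by blast
  obtain s where s: "[b * s = 1] (mod int q)" using ab(2) cong_solve_coprime_int by blast
  \<comment> \<open>The quotient of \<open>a\<close> by \<open>b\<close> modulo
    \<open>q\<close>.\<close>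
  define t where "t = a * s"
  have sd: "[b * s = 1] (mod int d)"
    using s assms(2) cong_dvd_mono_modulus int_dvd_int_iff by blast
  have td: "[t = 1] (mod int d)"
    using cong_trans[OF cong_scalar_right[OF ab(3), of s] sd] by (simp add: t_def)
  have "coprime (b * s) (int q)" using s by (metis cong_imp_coprime cong_sym coprime_1_left)
  then have tq: "coprime t (int q)" using ab(1) by (simp add: t_def)
  have "chi b * chi s = 1"
    using dirichlet_char_cong[OF chi s] by (simp add: dirichlet_char_mult[OF chi] dirichlet_char_1[OF chi])
  then have t1: "chi t \<noteq> 1"
    using ab(4) by (metis dirichlet_char_mult[OF chi] t_def mult.commute mult_cancel_left mult_zero_left zero_neq_one)
  let ?G = "\<lambda>a. chi a * F a"
  have "chi t * (\<Sum>a = 0..<int q. ?G a) = (\<Sum>a = 0..<int q. ?G (t * a))"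
    unfolding sum_distrib_left
  proof (intro sum.cong refl)
    fix x
    have "F (t * x) = F x" using F[OF cong_scalar_right[OF td, of x]] by simp
    then show "chi t * (chi x * F x) = chi (t * x) * F (t * x)" by (simp add: dirichlet_char_mult[OF chi])
  qed
  also have "\<dots> = (\<Sum>a = 0..<int q. ?G a)"
  proof (rule sum_residues_mult[OF tq])
    fix a b assume "[a = b] (mod int q)"
    then show "?G a = ?G b"
      using dirichlet_char_cong[OF chi] F assms(2) cong_dvd_mono_modulus int_dvd_int_iff by metis
  qed
  finally show ?thesis using t1 by simp
qed

text \<open>Separability, as for Gauss sums, but for any periodic \<open>F\<close>. For a unit
  \<open>N\<close>, substitute. Otherwise \<open>F (N * a)\<close> has period
  \<open>q div gcd\<close> in \<open>a\<close>, a modulus that a primitive character cannot factor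
  through, and both sides are 0.\<close>

lemma sum_primitive_char_scale:
  assumes prim: "primitive_char q chi" and F: "\<And>a b. [a = b] (mod int q) \<Longrightarrow> F a = F b"
  shows "(\<Sum>a = 0..<int q. chi a * F (N * a)) = cnj (chi N) * (\<Sum>a = 0..<int q. chi a * F a)"
proof -
  have chi: "dirichlet_char q chi" using prim by (rule primitive_char_imp_dirichlet_char)
  have q: "q > 0" using chi by (rule dirichlet_char_modulus_pos)
  show ?thesis
  proof (cases "coprime N (int q)")
    case True
    let ?G = "\<lambda>a. cnj (chi N) * chi a * F a"
    have "(\<Sum>a = 0..<int q. chi a * F (N * a)) = (\<Sum>a = 0..<int q. ?G (N * a))"
      using dirichlet_char_mult_cnj[OF chi True]
      by (intro sum.cong refl) (simp add: dirichlet_char_mult[OF chi] mult.commute mult.left_commute)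
    also have "\<dots> = (\<Sum>a = 0..<int q. ?G a)"
    proof (rule sum_residues_mult[OF True])
      fix a b assume "[a = b] (mod int q)"
      then show "?G a = ?G b" using dirichlet_char_cong[OF chi] F by metis
    qed
    also have "\<dots> = cnj (chi N) * (\<Sum>a = 0..<int q. chi a * F a)"
      by (simp add: sum_distrib_left mult_ac)
    finally show ?thesis .
  next
    case False
    define g where "g = nat (gcd N (int q))"
    have g: "int g = gcd N (int q)" by (simp add: g_def)
    have gq: "g dvd q" by (metis g gcd_dvd2 int_dvd_int_iff)
    have g1: "g > 1"
    proof -
      have "gcd N (int q) > 0" using q by (simp add: gcd_pos_int)
      then show ?thesis using False g unfolding coprime_iff_gcd_eq_1 by linarith
    qed
    define d where "d = q div g"
    have qd: "q = g * d" using gq by (simp add: d_def)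
    have dq: "d dvd q" by (simp add: qd)
    have "d < q" using g1 q by (simp add: d_def)
    then have "\<not> factors_through d q chi"
      using prim factors_through_iff_induces[OF chi dq] unfolding primitive_char_def by blast
    then have "(\<Sum>a = 0..<int q. chi a * F (N * a)) = 0"
    proof (rule sum_char_periodic_eq_0[OF chi dq])
      fix a b :: int
      assume "[a = b] (mod int d)"
      then have "int d dvd a - b" by (simp add: cong_iff_dvd_diff)
      moreover have "int g dvd N" by (simp add: g)
      ultimately have "int g * int d dvd N * (a - b)" by (intro mult_dvd_mono)
      then have "[N * a = N * b] (mod int q)" by (simp add: cong_iff_dvd_diff qd right_diff_distrib)
      then show "F (N * a) = F (N * b)" by (rule F)
    qed
    moreover have "chi N = 0" using False dirichlet_char_eq_0_iff[OF chi] by blast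
    ultimately show ?thesis by simp
  qed
qed

section \<open>Moebius inversion and sums over residues\<close>

text \<open>Subsets containing a fixed element cancel against those without it.\<close>

lemma sum_Pow_alternating:
  assumes "finite P"
  shows "(\<Sum>S\<in>Pow P. (- 1) ^ card S) = (if P = {} then 1 else 0 :: int)"
  using assms
proof (induction P rule: finite_induct)
  case (insert x P)
  have "(\<Sum>S\<in>insert x ` Pow P. (- 1) ^ card S) = (\<Sum>S\<in>Pow P. (- 1) ^ card (insert x S) :: int)"
    by (rule sum.reindex_cong[of "insert x"]) (use insert.hyps in \<open>auto simp: inj_on_def\<close>)
  also have "\<dots> = - (\<Sum>S\<in>Pow P. (- 1) ^ card S)"
    unfolding sum_negf[symmetric]
  proof (rule sum.cong[OF refl])
    fix S assume "S \<in> Pow P"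
    then have "x \<notin> S" "finite S" using insert.hyps by (auto intro: finite_subset)
    then show "(- 1) ^ card (insert x S) = - ((- 1) ^ card S :: int)" by simp
  qed
  finally have "(\<Sum>S\<in>Pow (insert x P). (- 1) ^ card S) = (0 :: int)"
    unfolding Pow_insert using insert.hyps by (subst sum.union_disjoint) auto
  then show ?case by simp
qed simp

text \<open>Only squarefree divisors contribute, and these correspond to the subsets of the prime
  factors of \<open>n\<close>, with the product as inverse map.\<close>

lemma sum_moebius_divisors:
  assumes "n > 0"
  shows "(\<Sum>k | k dvd n. moebius k) = (if n = 1 then 1 else 0)"
proof -
  let ?P = "prime_factors n"
  have prime: "prime p" if "p \<in> S" "S \<subseteq> ?P" for p S using that by auto
  have pf: "prime_factors (\<Prod>S) = S" if S: "S \<subseteq> ?P" for S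
  proof -
    have fin: "finite S" using S by (rule finite_subset) simp
    have "0 \<notin> id ` S" using prime[OF _ S, of 0] by auto
    then have "prime_factors (prod id S) = \<Union> ((prime_factors \<circ> id) ` S)"
      using fin by (intro prime_factors_prod) auto
    also have "\<dots> = S" using prime[OF _ S] by (auto simp: prime_prime_factors)
    finally show ?thesis by simp
  qed
  have sqf: "squarefree (\<Prod>S)" if S: "S \<subseteq> ?P" for S
    using prime[OF _ S] by (intro squarefree_prod_coprime) (auto intro: primes_coprime squarefree_prime)
  have dvd: "\<Prod>S dvd n" if S: "S \<subseteq> ?P" for S
  proof -
    have "mset_set S \<subseteq># mset_set ?P" using S by (simp add: subset_imp_msubset_mset_set)
    also have "\<dots> \<subseteq># prime_factorization n" by (rule mset_set_set_mset_msubset)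
    finally have "prod_mset (mset_set S) dvd prod_mset (prime_factorization n)"
      by (rule prod_mset_subset_imp_dvd)
    then show ?thesis using assms by (simp add: prod_mset_prime_factorization_nat prod_unfold_prod_mset)
  qed
  have prod: "\<Prod>(prime_factors k) = k" if "squarefree k" for k :: nat
  proof -
    have k: "k > 0" using that by (auto intro: Nat.gr0I)
    have "(\<Prod>p\<in>prime_factors k. p ^ multiplicity p k) = k"
      using k prod_prime_factors[of k] by simp
    moreover have "multiplicity p k = 1" if "p \<in> prime_factors k" for p
      using that \<open>squarefree k\<close> k squarefree_factorial_semiring''[of k]
      by (auto simp: prime_factors_multiplicity le_Suc_eq)
    ultimately show ?thesis by simp
  qed
  have "(\<Sum>k | k dvd n. moebius k) = (\<Sum>k | k dvd n \<and> squarefree k. (- 1) ^ card (prime_factors k))"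
    using assms by (intro sum.mono_neutral_cong_right) (auto simp: moebius_def)
  also have "\<dots> = (\<Sum>S\<in>Pow ?P. (- 1) ^ card S)"
    by (rule sum.reindex_bij_witness[of _ "\<lambda>S. \<Prod>S" prime_factors])
       (use assms pf sqf dvd prod in \<open>auto simp: dvd_prime_factors intro: dvd_prime_factors[THEN subsetD]\<close>)
  also have "\<dots> = (if ?P = {} then 1 else 0)"
    by (rule sum_Pow_alternating) simp
  also have "?P = {} \<longleftrightarrow> n = 1"
    using assms by (auto simp: prime_factorization_empty_iff)
  finally show ?thesis .
qed

lemma sum_blocks:
  fixes G :: "int \<Rightarrow> 'a :: comm_monoid_add"
  shows "(\<Sum>a = 0..<int (q * N). G a) = (\<Sum>b = 0..<int q. \<Sum>t<N. G (b + int q * int t))"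
proof (induction N)
  case (Suc N)
  have "{0..<int (q * Suc N)} = {0..<int (q * N)} \<union> {int (q * N)..<int (q * N) + int q}"
    by (subst ivl_disj_un_two(3)) (simp_all add: algebra_simps)
  then have "(\<Sum>a = 0..<int (q * Suc N). G a)
      = (\<Sum>a = 0..<int (q * N). G a) + (\<Sum>a = int (q * N)..<int (q * N) + int q. G a)"
    by (simp only:) (rule sum.union_disjoint, auto)
  also have "(\<Sum>a = int (q * N)..<int (q * N) + int q. G a) = (\<Sum>b = 0..<int q. G (b + int q * int N))"
    by (rule sum.reindex_bij_witness[of _ "\<lambda>b. b + int q * int N" "\<lambda>a. a - int q * int N"]) auto
  finally show ?case using Suc by (simp add: sum.distrib)
qed simp

lemma sum_multiples:
  fixes G :: "int \<Rightarrow> 'a :: comm_monoid_add"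
  assumes "k > 0"
  shows "(\<Sum>a = 0..<int (k * m). if int k dvd a then G a else 0) = (\<Sum>b = 0..<int m. G (int k * b))"
proof -
  have "(\<Sum>a = 0..<int (k * m). if int k dvd a then G a else 0)
      = (\<Sum>a | a \<in> {0..<int (k * m)} \<and> int k dvd a. G a)"
    by (intro sum.mono_neutral_cong_right) auto
  also have "\<dots> = (\<Sum>b = 0..<int m. G (int k * b))"
    by (rule sum.reindex_bij_witness[of _ "\<lambda>b. int k * b" "\<lambda>a. a div int k"])
       (use assms in \<open>auto simp: zero_le_mult_iff\<close>)
  finally show ?thesis .
qed

text \<open>Dividing \<open>j\<close> and \<open>c\<close> by their gcd gives \<open>b\<close> and
  \<open>d\<close>; the residue 0 belongs to \<open>d = 1\<close>, \<open>b = 0\<close>.\<close>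

lemma sum_residues_by_gcd:
  fixes F :: "int \<Rightarrow> 'a :: comm_monoid_add"
  assumes "c > 0"
  shows "(\<Sum>j = 0..<int c. F j) =
    (\<Sum>d | d dvd c. \<Sum>b\<in>unit_residues d. F (int (c div d) * b))"
proof -
  have fin: "finite {d. d dvd c}" using assms by simp
  have *: "0 < gcd j (int c)" for j using assms by (simp add: gcd_pos_int)
  have "(\<Sum>d | d dvd c. \<Sum>b\<in>unit_residues d. F (int (c div d) * b))
      = (\<Sum>(d, b)\<in>Sigma {d. d dvd c} unit_residues. F (int (c div d) * b))"
    by (rule sum.Sigma) (use fin finite_unit_residues in blast)+
  also have "\<dots> = (\<Sum>j = 0..<int c. F j)"
  proof (rule sum.reindex_bij_witness[of _ "\<lambda>j. (c div nat (gcd j (int c)), j div gcd j (int c))"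
      "\<lambda>(d, b). int (c div d) * b"], goal_cases)
    case (1 x)
    then obtain d b where x: "x = (d, b)" and d: "d dvd c" and b: "b \<in> unit_residues d" by blast
    define e where "e = c div d"
    have c: "c = e * d" using d by (simp add: e_def)
    then have pos: "e > 0" "d > 0" using assms by auto
    have "gcd (int e * b) (int c) = int e * gcd b (int d)"
      unfolding c of_nat_mult gcd_mult_left by (simp add: abs_mult)
    then have "gcd (int e * b) (int c) = int e" using b by simp
    then show ?case using pos by (simp add: x c)
  next
    case (2 x)
    then obtain d b where x: "x = (d, b)" and d: "d dvd c" and b: "b \<in> unit_residues d" by blast
    define e where "e = c div d"
    have c: "c = e * d" using d by (simp add: e_def)
    then have "e > 0" "d > 0" using assms by auto
    then show ?case using b by (simp add: x c)
  next
    case (3 j)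
    let ?g = "gcd j (int c)"
    define g where "g = nat ?g"
    have g: "int g = ?g" by (simp add: g_def)
    have gc: "g dvd c" by (metis g gcd_dvd2 int_dvd_int_iff)
    then obtain e where e: "c = g * e" by blast
    have "c div (c div g) = g" using assms by (auto simp: e)
    then show ?case by (simp add: g_def[symmetric] g)
  next
    case (4 j)
    let ?g = "gcd j (int c)"
    define g where "g = nat ?g"
    have g: "int g = ?g" by (simp add: g_def)
    have gc: "g dvd c" by (metis g gcd_dvd2 int_dvd_int_iff)
    have cg: "int (c div g) = int c div ?g" by (simp add: zdiv_int g)
    have "coprime (j div ?g) (int c div ?g)" using assms by (intro div_gcd_coprime) simp
    moreover have "j div ?g < int c div ?g"
    proof -
      have "j = ?g * (j div ?g)" "int c = ?g * (int c div ?g)" by simp_all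
      then show ?thesis using 4 *[of j] by (metis atLeastLessThan_iff mult_less_cancel_left_pos)
    qed
    moreover have "0 \<le> j div ?g" using 4 *[of j] by (simp add: pos_imp_zdiv_nonneg_iff)
    ultimately show ?case using gc by (simp add: g_def[symmetric] cg div_dvd_iff_mult) (metis dvd_div_mult_self dvd_triv_left)
  qed (auto simp: case_prod_unfold)
  finally show ?thesis by (rule sym)
qed

text \<open>The divisors of \<open>d\<close> that divide \<open>a\<close> are the divisors of their
  gcd.\<close>

lemma moebius_indicator:
  assumes "d > 0"
  shows "(\<Sum>k | k dvd d. if int k dvd a then moebius k else 0) = (if coprime a (int d) then 1 else 0)"
proof -
  define g where "g = nat (gcd a (int d))"
  have g: "int g = gcd a (int d)" by (simp add: g_def)
  have g0: "g > 0" using assms g by (metis gcd_eq_0_iff not_gr0 of_nat_0_eq_iff of_nat_0 less_irrefl)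
  have "{k. k dvd g} = {k. k dvd d \<and> int k dvd a}"
    by (auto simp: g simp flip: int_dvd_int_iff)
  then have "(\<Sum>k | k dvd d. if int k dvd a then moebius k else 0) = (\<Sum>k | k dvd g. moebius k)"
    using assms by (intro sum.mono_neutral_cong_right) auto
  also have "\<dots> = (if g = 1 then 1 else 0)" by (rule sum_moebius_divisors[OF g0])
  also have "g = 1 \<longleftrightarrow> coprime a (int d)"
    using g by (simp add: coprime_iff_gcd_eq_1 flip: g)
  finally show ?thesis .
qed

text \<open>Moebius inversion removes the coprimality condition; then \<open>a = k * b\<close>, and
  \<open>b\<close> modulo \<open>d div k\<close> is split into its residue modulo \<open>q\<close>
  and a block index \<open>t\<close>.\<close>

lemma sum_unit_residues_twisted:
  fixes H :: "real \<Rightarrow> complex"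
  assumes psi: "dirichlet_char q \<psi>" and "q dvd d" and d: "d > 0"
  shows "(\<Sum>a\<in>unit_residues d. \<psi> a * H (of_int a / real d)) =
    (\<Sum>k | k dvd d. of_int (moebius k) * \<psi> (int k) *
      (\<Sum>b = 0..<int q. \<psi> b * (\<Sum>t<d div (k * q). H ((of_int b / real q + real t) / real (d div (k * q))))))"
proof -
  have q: "q > 0" using psi by (rule dirichlet_char_modulus_pos)
  define f where "f a = \<psi> a * H (of_int a / real d)" for a
  have "(\<Sum>a\<in>unit_residues d. f a) = (\<Sum>a = 0..<int d. of_int (if coprime a (int d) then 1 else 0) * f a)"
    by (intro sum.mono_neutral_cong_left) auto
  also have "\<dots> = (\<Sum>a = 0..<int d. \<Sum>k | k dvd d. if int k dvd a then of_int (moebius k) * f a else 0)"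
    unfolding moebius_indicator[OF d, symmetric] of_int_sum sum_distrib_right
    by (intro sum.cong refl) auto
  also have "\<dots> = (\<Sum>k | k dvd d. \<Sum>a = 0..<int d. if int k dvd a then of_int (moebius k) * f a else 0)"
    by (rule sum.swap)
  also have "\<dots> = (\<Sum>k | k dvd d. of_int (moebius k) * \<psi> (int k) *
      (\<Sum>b = 0..<int q. \<psi> b * (\<Sum>t<d div (k * q). H ((of_int b / real q + real t) / real (d div (k * q))))))"
  proof (rule sum.cong[OF refl])
    fix k assume "k \<in> {k. k dvd d}"
    then obtain m where m: "d = k * m" by blast
    then have k: "k > 0" "m > 0" using d by auto
    have "(\<Sum>a = 0..<int d. if int k dvd a then of_int (moebius k) * f a else 0)
        = (\<Sum>b = 0..<int m. of_int (moebius k) * f (int k * b))"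
      unfolding m by (rule sum_multiples[OF k(1)])
    also have "\<dots> = of_int (moebius k) * \<psi> (int k) * (\<Sum>b = 0..<int m. \<psi> b * H (of_int b / real m))"
      using k unfolding sum_distrib_left
      by (intro sum.cong refl) (simp add: f_def m dirichlet_char_mult[OF psi])
    also have "\<dots> = of_int (moebius k) * \<psi> (int k) *
      (\<Sum>b = 0..<int q. \<psi> b * (\<Sum>t<d div (k * q). H ((of_int b / real q + real t) / real (d div (k * q)))))"
    \<comment> \<open>For \<open>k\<close> prime to \<open>q\<close>, the modulus \<open>q\<close>
      divides \<open>m\<close>. For other \<open>k\<close> the quotient \<open>d div (k * q)\<close>
      may be rounded down, which is harmless because \<open>\<psi> (int k)\<close> is 0.\<close>
    proof (cases "coprime (int k) (int q)")
      case True
      then have "q dvd m" using assms(2) unfolding m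
        by (metis coprime_commute coprime_dvd_mult_right_iff coprime_int_iff)
      then obtain N where N: "m = q * N" by blast
      then have N0: "N > 0" using k by (auto intro: Nat.gr0I)
      have dN: "d div (k * q) = N" using k q by (simp add: m N mult.assoc[symmetric])
      have "\<psi> (b + int q * int t) = \<psi> b" for b t
        by (rule dirichlet_char_cong[OF psi]) (simp add: cong_def)
      moreover have "of_int (b + int q * int t) / real m = (of_int b / real q + real t) / real N" for b t
        using q N0 by (simp add: N field_simps)
      ultimately have "(\<Sum>b = 0..<int m. \<psi> b * H (of_int b / real m))
          = (\<Sum>b = 0..<int q. \<psi> b * (\<Sum>t<N. H ((of_int b / real q + real t) / real N)))"
        unfolding N sum_blocks sum_distrib_left by (simp only:)
      then show ?thesis unfolding dN by (simp only:)
    next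
      case False
      then have "\<psi> (int k) = 0" using dirichlet_char_eq_0_iff[OF psi] by blast
      then show ?thesis by simp
    qed
    finally show "(\<Sum>a = 0..<int d. if int k dvd a then of_int (moebius k) * f a else 0) = \<dots>" .
  qed
  finally show ?thesis by (simp only: f_def)
qed

section \<open>Twisted sums of the sawtooth function\<close>

lemma cis_frac_cong:
  assumes "q > 0" "[a = b] (mod int q)"
  shows "cis (2 * pi * (of_int a / real q)) = cis (2 * pi * (of_int b / real q))"
proof -
  obtain k where "b = a + int q * k" using assms(2) unfolding cong_iff_lin by blast
  then have "2 * pi * (of_int b / real q) = 2 * pi * (of_int a / real q) + 2 * pi * of_int k"
    using assms(1) by (simp add: field_simps)
  then show ?thesis by (simp add: cis_mult[symmetric] cis_multiple_2pi)
qed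

lemma B1_frac_cong:
  assumes "q > 0" "[a = b] (mod int q)"
  shows "B1 (of_int a / real q + x) = B1 (of_int b / real q + x)"
proof -
  obtain k where "b = a + int q * k" using assms(2) unfolding cong_iff_lin by blast
  then have "of_int b / real q + x = of_int a / real q + x + of_int k"
    using assms(1) by (simp add: field_simps)
  then show ?thesis by (simp only: B1_add_int)
qed

text \<open>The case of \<open>sum_primitive_char_scale\<close> where the periodic function is an
  additive character.\<close>

lemma gauss_sum_separable:
  assumes "primitive_char q chi"
  shows "(\<Sum>n = 0..<int q. chi n * cis (2 * pi * (of_int l * (of_int n / real q)))) =
    cnj (chi l) * gauss_sum q chi"
proof -
  have q: "q > 0"
    using assms by (intro dirichlet_char_modulus_pos[OF primitive_char_imp_dirichlet_char])
  have "gauss_sum q chi = (\<Sum>n = 0..<int q. chi n * cis (2 * pi * (of_int n / real q)))"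
    unfolding gauss_sum_def by (intro sum.cong refl) (simp add: cis_conv_exp mult_ac)
  then show ?thesis
    using sum_primitive_char_scale[OF assms, of "\<lambda>n. cis (2 * pi * (of_int n / real q))" l]
      cis_frac_cong[OF q] by simp
qed

text \<open>In the Fourier series of \<open>B1\<close> each frequency \<open>l\<close> contributes a
  product of two separable Gauss sums, hence \<open>T * \<eta> l\<close>. As \<open>\<eta>\<close>
  is odd, the frequencies k and -k reinforce each other and an L-series remains.\<close>

lemma double_B1_sum_odd:
  assumes A: "primitive_char p A" and B: "primitive_char q B" and odd: "A (- 1) * B (- 1) = - 1"
  shows "\<i> * pi * (\<Sum>b = 0..<int q. \<Sum>n = 0..<int p. B b * A n * B1 (of_int n / real p + of_int b / real q)) =
    - (gauss_sum p A * gauss_sum q B * L_one (\<lambda>l. cnj (B l) * cnj (A l)))"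
proof -
  have dA: "dirichlet_char p A" and dB: "dirichlet_char q B"
    using A B by (auto intro: primitive_char_imp_dirichlet_char)
  define T where "T = gauss_sum p A * gauss_sum q B"
  define \<eta> where "\<eta> l = cnj (B l) * cnj (A l)" for l
  define x where "x b n = of_int n / real p + of_int b / real q" for b n
  define Z where "Z = (\<Sum>b = 0..<int q. \<Sum>n = 0..<int p. B b * A n * B1 (x b n))"
  have E: "(\<Sum>b = 0..<int q. \<Sum>n = 0..<int p. B b * A n * cis (2 * pi * (of_int l * x b n))) = T * \<eta> l" for l
  proof -
    have "(\<Sum>b = 0..<int q. \<Sum>n = 0..<int p. B b * A n * cis (2 * pi * (of_int l * x b n)))
        = (\<Sum>b = 0..<int q. B b * cis (2 * pi * (of_int l * (of_int b / real q))))
          * (\<Sum>n = 0..<int p. A n * cis (2 * pi * (of_int l * (of_int n / real p))))"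
      unfolding sum_product
      by (intro sum.cong refl) (simp add: x_def distrib_left mult_ac flip: cis_mult)
    then show ?thesis
      unfolding gauss_sum_separable[OF A] gauss_sum_separable[OF B] by (simp add: T_def \<eta>_def mult_ac)
  qed
  have \<eta>_odd: "\<eta> (- l) = - \<eta> l" for l
  proof -
    have "\<eta> (- l) = cnj (A (- 1) * B (- 1)) * \<eta> l"
      by (simp add: \<eta>_def dirichlet_char_minus[OF dA, of l] dirichlet_char_minus[OF dB, of l] mult_ac)
    then show ?thesis unfolding odd by simp
  qed
  have "(\<lambda>k. \<Sum>b = 0..<int q. \<Sum>n = 0..<int p. B b * A n *
      ((cis (2 * pi * (real (Suc k) * x b n)) - cis (- (2 * pi * (real (Suc k) * x b n)))) / of_nat (Suc k)))
     sums (\<Sum>b = 0..<int q. \<Sum>n = 0..<int p. B b * A n * (- (2 * pi * \<i> * B1 (x b n))))"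
    by (intro sums_sum sums_mult B1_fourier)
  also have "(\<Sum>b = 0..<int q. \<Sum>n = 0..<int p. B b * A n * (- (2 * pi * \<i> * B1 (x b n)))) = - (2 * pi * \<i> * Z)"
    by (simp add: Z_def sum_distrib_left sum_negf mult_ac)
  also have "(\<lambda>k. \<Sum>b = 0..<int q. \<Sum>n = 0..<int p. B b * A n *
      ((cis (2 * pi * (real (Suc k) * x b n)) - cis (- (2 * pi * (real (Suc k) * x b n)))) / of_nat (Suc k)))
     = (\<lambda>k. 2 * T * (\<eta> (int (Suc k)) / of_nat (Suc k)))"
  proof
    fix k
    have neg: "2 * pi * (of_int (- int (Suc k)) * y) = - (2 * pi * (real (Suc k) * y))" for y
      by (simp only: of_int_minus of_int_of_nat_eq mult_minus_left mult_minus_right)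
    have "(\<Sum>b = 0..<int q. \<Sum>n = 0..<int p. B b * A n *
      ((cis (2 * pi * (real (Suc k) * x b n)) - cis (- (2 * pi * (real (Suc k) * x b n)))) / of_nat (Suc k)))
      = ((\<Sum>b = 0..<int q. \<Sum>n = 0..<int p. B b * A n * cis (2 * pi * (of_int (int (Suc k)) * x b n)))
       - (\<Sum>b = 0..<int q. \<Sum>n = 0..<int p. B b * A n * cis (2 * pi * (of_int (- int (Suc k)) * x b n)))) / of_nat (Suc k)"
      unfolding neg sum_subtractf[symmetric] sum_divide_distrib
      by (intro sum.cong refl) (simp add: diff_divide_distrib right_diff_distrib)
    also have "\<dots> = 2 * T * (\<eta> (int (Suc k)) / of_nat (Suc k))"
      unfolding E \<eta>_odd by (simp add: field_simps)
    finally show "(\<Sum>b = 0..<int q. \<Sum>n = 0..<int p. B b * A n *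
      ((cis (2 * pi * (real (Suc k) * x b n)) - cis (- (2 * pi * (real (Suc k) * x b n)))) / of_nat (Suc k))) = \<dots>" .
  qed
  finally have sums: "(\<lambda>k. 2 * T * (\<eta> (int (Suc k)) / of_nat (Suc k))) sums (- (2 * pi * \<i> * Z))" .
  have "2 * T * L_one \<eta> = - (2 * pi * \<i> * Z)"
  proof (cases "T = 0")
    case True
    \<comment> \<open>Both sides vanish, so neither nonvanishing of the Gauss sums nor convergence of the series is needed.\<close>
    then have "(\<lambda>_. 0) sums (- (2 * pi * \<i> * Z))" using sums by simp
    then have "- (2 * pi * \<i> * Z) = 0" by (rule sums_unique2) (rule sums_zero)
    then show ?thesis using True by simp
  next
    case False
    then have "(\<lambda>k. \<eta> (int (Suc k)) / of_nat (Suc k)) sums (- (2 * pi * \<i> * Z) / (2 * T))"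
      using sums_divide[OF sums, of "2 * T"] by simp
    then have "L_one \<eta> = - (2 * pi * \<i> * Z) / (2 * T)"
      unfolding L_one_def by (rule sums_unique[symmetric])
    then show ?thesis using False by simp
  qed
  then have "\<i> * pi * Z = - (T * L_one \<eta>)" by (simp add: mult_ac)
  then show ?thesis by (simp add: Z_def T_def \<eta>_def[abs_def] x_def)
qed

text \<open>Negating both summation variables fixes the product of the characters and changes the
  sign of \<open>B1\<close>, so the sum is its own negative.\<close>

lemma double_B1_sum_even:
  assumes A: "dirichlet_char p A" and B: "dirichlet_char q B" and even: "A (- 1) * B (- 1) = 1"
  shows "(\<Sum>b = 0..<int q. \<Sum>n = 0..<int p. B b * A n * complex_of_real (B1 (of_int n / real p + of_int b / real q))) = 0"
proof -
  have p: "p > 0" and q: "q > 0" using A B by (auto intro: dirichlet_char_modulus_pos)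
  define G where "G b n = B b * A n * complex_of_real (B1 (of_int n / real p + of_int b / real q))" for b n
  have A_cong: "G b n = G b n'" if "[n = n'] (mod int p)" for b n n'
    unfolding G_def using dirichlet_char_cong[OF A that] B1_frac_cong[OF p that] by simp
  have B_cong: "G b n = G b' n" if "[b = b'] (mod int q)" for b b' n
    unfolding G_def using dirichlet_char_cong[OF B that] B1_frac_cong[OF q that, of "of_int n / real p"]
    by (simp add: add.commute)
  have neg: "G (- b) (- n) = - G b n" for b n
  proof -
    have "G (- b) (- n) = (A (- 1) * B (- 1)) * (B b * A n) *
        complex_of_real (B1 (- (of_int n / real p + of_int b / real q)))"
      by (simp add: G_def dirichlet_char_minus[OF A, of n] dirichlet_char_minus[OF B, of b] mult_ac)
    then show ?thesis unfolding even B1_minus by (simp add: G_def)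
  qed
  have "(\<Sum>b = 0..<int q. \<Sum>n = 0..<int p. G b n) = (\<Sum>b = 0..<int q. \<Sum>n = 0..<int p. G (- 1 * b) n)"
    by (rule sum_residues_mult[symmetric]) (auto intro: sum.cong B_cong)
  also have "\<dots> = (\<Sum>b = 0..<int q. \<Sum>n = 0..<int p. G (- 1 * b) (- 1 * n))"
  proof (rule sum.cong[OF refl])
    fix b
    show "(\<Sum>n = 0..<int p. G (- 1 * b) n) = (\<Sum>n = 0..<int p. G (- 1 * b) (- 1 * n))"
      by (rule sum_residues_mult[symmetric]) (auto intro: A_cong)
  qed
  also have "\<dots> = - (\<Sum>b = 0..<int q. \<Sum>n = 0..<int p. G b n)"
    by (simp add: neg sum_negf)
  finally show ?thesis by (simp add: G_def)
qed

text \<open>Summing over \<open>t\<close> by the distribution relation multiplies \<open>n\<close>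
  by \<open>N\<close> inside \<open>B1\<close>, and primitivity then extracts the factor
  \<open>cnj (A (int N))\<close>.\<close>

lemma primitive_B1_distribution:
  assumes A: "primitive_char p A" and N: "N > 0"
  shows "(\<Sum>t<N. \<Sum>n = 0..<int p. A n * complex_of_real (B1 (of_int n / real p + (x + real t) / real N))) =
    cnj (A (int N)) * (\<Sum>n = 0..<int p. A n * complex_of_real (B1 (of_int n / real p + x)))"
proof -
  have p: "p > 0"
    using A by (intro dirichlet_char_modulus_pos[OF primitive_char_imp_dirichlet_char])
  have distrib: "(\<Sum>t<N. B1 (of_int n / real p + (x + real t) / real N)) = B1 (of_int (int N * n) / real p + x)" for n
  proof -
    have "of_int n / real p + (x + real t) / real N = ((of_int (int N * n) / real p + x) + real t) / real N" for t
      using p N by (simp add: field_simps)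
    then show ?thesis by (simp only: B1_distribution[OF N])
  qed
  have "(\<Sum>t<N. \<Sum>n = 0..<int p. A n * complex_of_real (B1 (of_int n / real p + (x + real t) / real N)))
      = (\<Sum>n = 0..<int p. A n * complex_of_real (\<Sum>t<N. B1 (of_int n / real p + (x + real t) / real N)))"
    unfolding of_real_sum sum_distrib_left by (rule sum.swap)
  also have "\<dots> = (\<Sum>n = 0..<int p. A n * complex_of_real (B1 (of_int (int N * n) / real p + x)))"
    by (simp only: distrib)
  also have "\<dots> = cnj (A (int N)) * (\<Sum>n = 0..<int p. A n * complex_of_real (B1 (of_int n / real p + x)))"
    by (rule sum_primitive_char_scale[OF A, of "\<lambda>a. complex_of_real (B1 (of_int a / real p + x))"])
       (simp only: B1_frac_cong[OF p])
  finally show ?thesis .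
qed

text \<open>Taking the trivial character modulo 1 for \<open>A\<close> gives the sum with a single \<open>B1\<close>.\<close>

lemma sum_unit_residues_char_B1:
  assumes A: "primitive_char p A" and psi: "dirichlet_char q \<psi>" and "q dvd d" "d > 0"
  shows "(\<Sum>a\<in>unit_residues d. \<psi> a * (\<Sum>n = 0..<int p. A n * complex_of_real (B1 (of_int n / real p + of_int a / real d)))) =
    (\<Sum>k | k dvd d. of_int (moebius k) * \<psi> (int k) * cnj (A (int (d div (k * q))))) *
    (\<Sum>b = 0..<int q. \<Sum>n = 0..<int p. \<psi> b * A n * complex_of_real (B1 (of_int n / real p + of_int b / real q)))"
proof -
  define Y where "Y y = (\<Sum>n = 0..<int p. A n * complex_of_real (B1 (of_int n / real p + y)))" for y
  have "(\<Sum>a\<in>unit_residues d. \<psi> a * Y (of_int a / real d)) = (\<Sum>k | k dvd d. of_int (moebius k) * \<psi> (int k) *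
      (\<Sum>b = 0..<int q. \<psi> b * (\<Sum>t<d div (k * q). Y ((of_int b / real q + real t) / real (d div (k * q))))))"
    by (rule sum_unit_residues_twisted[OF psi assms(3,4)])
  also have "\<dots> = (\<Sum>k | k dvd d. of_int (moebius k) * \<psi> (int k) * cnj (A (int (d div (k * q)))) *
      (\<Sum>b = 0..<int q. \<psi> b * Y (of_int b / real q)))"
  proof (rule sum.cong[OF refl])
    fix k assume "k \<in> {k. k dvd d}"
    then have k: "k dvd d" by simp
    show "of_int (moebius k) * \<psi> (int k) *
        (\<Sum>b = 0..<int q. \<psi> b * (\<Sum>t<d div (k * q). Y ((of_int b / real q + real t) / real (d div (k * q)))))
      = of_int (moebius k) * \<psi> (int k) * cnj (A (int (d div (k * q)))) * (\<Sum>b = 0..<int q. \<psi> b * Y (of_int b / real q))"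
    proof (cases "\<psi> (int k) = 0")
      case False
      then have "coprime k q" using dirichlet_char_eq_0_iff[OF psi, of "int k"] by simp
      \<comment> \<open>Divisibility makes the number of values of \<open>t\<close> positive, as the
        distribution relation requires.\<close>
      then have "k * q dvd d" using k assms(3) by (simp add: divides_mult)
      then have N: "d div (k * q) > 0" using assms(4) by (auto simp: div_greater_zero_iff dvd_imp_le intro: Nat.gr0I)
      have "(\<Sum>t<d div (k * q). Y ((of_int b / real q + real t) / real (d div (k * q))))
          = cnj (A (int (d div (k * q)))) * Y (of_int b / real q)" for b
        unfolding Y_def by (rule primitive_B1_distribution[OF A N])
      then show ?thesis by (simp add: sum_distrib_left mult_ac)
    qed simp
  qed
  also have "\<dots> = (\<Sum>k | k dvd d. of_int (moebius k) * \<psi> (int k) * cnj (A (int (d div (k * q))))) *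
      (\<Sum>b = 0..<int q. \<psi> b * Y (of_int b / real q))"
    by (rule sum_distrib_right[symmetric])
  finally show ?thesis by (simp only: Y_def sum_distrib_left mult.assoc)
qed

section \<open>Averaging over the reduced residues\<close>

lemma sum_unit_residues_char_conv:
  assumes "dirichlet_char c chi"
  shows "(\<Sum>a\<in>unit_residues c. chi a * F a) = (\<Sum>a = 0..<int c. chi a * F a)"
  by (intro sum.mono_neutral_left) (auto simp: dirichlet_char_eq_0_iff[OF assms])

text \<open>If the conductor does not divide \<open>d\<close>, then \<open>\<xi>\<close> does not
  factor through \<open>d\<close> and the sum vanishes. Otherwise the summand can be made periodic
  modulo \<open>d\<close>, and multiplying the variable by \<open>b\<close> extracts the conjugate
  value.\<close>

lemma sum_unit_residues_char_reduce:
  assumes xi: "dirichlet_char c \<xi>" and dc: "d dvd c" and b: "coprime b (int d)"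
    and F: "\<And>a a'. [a = a'] (mod int d) \<Longrightarrow> F a = F a'"
  shows "(\<Sum>a\<in>unit_residues c. \<xi> a * F (a * b)) =
    (if conductor c \<xi> dvd d then
       of_nat (totient c) / of_nat (totient d) * cnj (star_char c \<xi> b) *
       (\<Sum>a\<in>unit_residues d. star_char c \<xi> a * F a)
     else 0)"
proof -
  have c: "c > 0" using xi by (rule dirichlet_char_modulus_pos)
  have d: "d > 0" using c dc by (auto intro: Nat.gr0I)
  have Fb: "F (a * b) = F (a' * b)" if "[a = a'] (mod int d)" for a a'
    by (rule F) (rule cong_scalar_right[OF that])
  show ?thesis
  proof (cases "conductor c \<xi> dvd d")
    case False
    then have "\<not> factors_through d c \<xi>" using conductor_dvd[OF xi dc] by blast
    then have "(\<Sum>a = 0..<int c. \<xi> a * F (a * b)) = 0"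
      by (rule sum_char_periodic_eq_0[OF xi dc]) (rule Fb)
    then show ?thesis using False unfolding sum_unit_residues_char_conv[OF xi] by simp
  next
    case True
    define \<psi> where "\<psi> = star_char c \<xi>"
    have psi: "dirichlet_char (conductor c \<xi>) \<psi>" unfolding \<psi>_def by (rule star_char_props[OF xi])
    have psi_cong: "\<psi> a = \<psi> a'" if "[a = a'] (mod int d)" for a a'
      using that True by (intro dirichlet_char_cong[OF psi] cong_dvd_mono_modulus[OF that]) simp
    \<comment> \<open>The primitive character agrees with \<open>\<xi>\<close> on units modulo
      \<open>c\<close> and is periodic modulo \<open>d\<close>, which \<open>\<xi>\<close> need not
      be.\<close>
    have "(\<Sum>a\<in>unit_residues c. \<xi> a * F (a * b)) = (\<Sum>a\<in>unit_residues c. \<psi> a * F (a * b))"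
      by (intro sum.cong refl) (simp add: \<psi>_def star_char_props(3)[OF xi])
    moreover have "of_nat (totient d) * (\<Sum>a\<in>unit_residues c. \<psi> a * F (a * b))
        = of_nat (totient c) * (\<Sum>a\<in>unit_residues d. \<psi> a * F (a * b))"
      by (rule sum_unit_residues_reduce[OF c dc]) (simp only: psi_cong Fb)
    moreover have "(\<Sum>a\<in>unit_residues d. \<psi> a * F (a * b)) = cnj (\<psi> b) * (\<Sum>a\<in>unit_residues d. \<psi> a * F a)"
    proof -
      have "coprime b (int (conductor c \<xi>))"
        using b True by (auto intro: coprime_divisors[of b b _ "int d"])
      then have inv: "\<psi> b * cnj (\<psi> b) = 1" by (rule dirichlet_char_mult_cnj[OF psi])
      have "\<psi> a * F (a * b) = cnj (\<psi> b) * (\<psi> (b * a) * F (b * a))" for a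
        using inv by (simp add: dirichlet_char_mult[OF psi] mult_ac)
      then have "(\<Sum>a\<in>unit_residues d. \<psi> a * F (a * b))
          = cnj (\<psi> b) * (\<Sum>a\<in>unit_residues d. \<psi> (b * a) * F (b * a))"
        by (simp only: sum_distrib_left)
      also have "(\<Sum>a\<in>unit_residues d. \<psi> (b * a) * F (b * a)) = (\<Sum>a\<in>unit_residues d. \<psi> a * F a)"
        by (rule sum_unit_residues_mult[OF b]) (simp only: psi_cong F)
      finally show ?thesis .
    qed
    ultimately show ?thesis using True d unfolding \<psi>_def by (simp add: field_simps)
  qed
qed

lemma dirichlet_char_times:
  assumes "dirichlet_char c chi" "dirichlet_char q \<psi>" "q dvd c"
  shows "dirichlet_char c (\<lambda>n. chi n * \<psi> n)"
  unfolding dirichlet_char_def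
proof (intro conjI allI)
  fix n
  have "\<psi> (n + int c) = \<psi> n"
    using assms(3) by (intro dirichlet_char_cong[OF assms(2)]) (auto simp: cong_iff_dvd_diff)
  then show "chi (n + int c) * \<psi> (n + int c) = chi n * \<psi> n"
    using assms(1) by (simp add: dirichlet_char_def)
  have "coprime n (int q)" if "coprime n (int c)"
    using that assms(3) by (auto intro: coprime_divisors[of n n _ "int c"])
  then show "chi n * \<psi> n = 0 \<longleftrightarrow> \<not> coprime n (int c)"
    by (auto simp: dirichlet_char_eq_0_iff[OF assms(1)] dirichlet_char_eq_0_iff[OF assms(2)])
qed (use assms in \<open>simp_all add: dirichlet_char_modulus_pos dirichlet_char_mult\<close>)

text \<open>On units modulo \<open>c\<close> both factors depend only on the residue modulo
  \<open>d\<close>, so the product factors through \<open>d\<close>. A unit \<open>b\<close> modulo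
  \<open>d\<close> is then lifted to a unit modulo \<open>c\<close>, where the identity holds by
  definition of the inducing characters.\<close>

lemma star_char_times:
  assumes xi: "dirichlet_char c \<xi>" and chi: "dirichlet_char q chi" and "d dvd c"
    and xd: "conductor c \<xi> dvd d" and qd: "q dvd d"
  shows "conductor c (\<lambda>n. \<xi> n * chi n) dvd d"
    and "coprime b (int d) \<Longrightarrow> star_char c (\<lambda>n. \<xi> n * chi n) b = star_char c \<xi> b * chi b"
proof -
  define \<eta> where "\<eta> n = \<xi> n * chi n" for n
  have c: "c > 0" using xi by (rule dirichlet_char_modulus_pos)
  have eta: "dirichlet_char c \<eta>"
    unfolding \<eta>_def by (rule dirichlet_char_times[OF xi chi dvd_trans[OF qd assms(3)]])
  have star_cong: "star_char c \<xi> a = star_char c \<xi> b" if "[a = b] (mod int d)" for a b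
    using that xd by (intro dirichlet_char_cong[OF star_char_props(1)[OF xi]] cong_dvd_mono_modulus[OF that]) simp
  have chi_cong: "chi a = chi b" if "[a = b] (mod int d)" for a b
    using that qd by (intro dirichlet_char_cong[OF chi] cong_dvd_mono_modulus[OF that]) simp
  have "factors_through d c \<eta>"
    unfolding factors_through_def
  proof (intro allI impI)
    fix a b assume a: "coprime a (int c)" and b: "coprime b (int c)" and ab: "[a = b] (mod int d)"
    have "\<xi> a = \<xi> b"
      using star_cong[OF ab] unfolding star_char_props(3)[OF xi a] star_char_props(3)[OF xi b] .
    then show "\<eta> a = \<eta> b" using chi_cong[OF ab] by (simp add: \<eta>_def)
  qed
  then have cond: "conductor c \<eta> dvd d" by (rule conductor_dvd[OF eta assms(3)])
  then show "conductor c (\<lambda>n. \<xi> n * chi n) dvd d" by (simp add: \<eta>_def[abs_def])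
  assume "coprime b (int d)"
  then obtain b' where b': "[b' = b] (mod int d)" "coprime b' (int c)"
    by (rule coprime_lift_residue[OF c])
  have "star_char c \<eta> b = star_char c \<eta> b'"
    using cond by (intro dirichlet_char_cong[OF star_char_props(1)[OF eta]]
      cong_dvd_mono_modulus[OF cong_sym[OF b'(1)]]) simp
  also have "\<dots> = \<xi> b' * chi b'" using star_char_props(3)[OF eta b'(2)] by (simp add: \<eta>_def)
  also have "\<dots> = star_char c \<xi> b * chi b"
    unfolding star_char_props(3)[OF xi b'(2)] using star_cong[OF b'(1)] chi_cong[OF b'(1)] by simp
  finally show "star_char c (\<lambda>n. \<xi> n * chi n) b = star_char c \<xi> b * chi b"
    by (simp add: \<eta>_def[abs_def])
qed

text \<open>A divisor \<open>k\<close> of \<open>d\<close> that does not divide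
  \<open>d div q\<close> shares a factor with \<open>q\<close>, so \<open>\<psi>\<close> kills it.
  Passing to complementary divisors of \<open>d div q\<close> gives the form used in
  \<open>g_factor\<close>.\<close>

lemma sum_divisors_swap:
  assumes psi: "dirichlet_char q \<psi>" and qd: "q dvd d" and d: "d > 0"
  shows "(\<Sum>k | k dvd d. of_int (moebius k) * \<psi> (int k) * f (d div (k * q))) =
    (\<Sum>k | k dvd d div q. f k * of_int (moebius (d div (k * q))) * \<psi> (int (d div (k * q))))"
proof -
  obtain e where e: "d = q * e" using qd by blast
  have pos: "q > 0" "e > 0" using d e by auto
  have de: "d div (k * q) = e div k" for k using pos by (simp add: e mult.commute[of k q])
  have "(\<Sum>k | k dvd d. of_int (moebius k) * \<psi> (int k) * f (e div k))
      = (\<Sum>k | k dvd e. of_int (moebius k) * \<psi> (int k) * f (e div k))"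
  proof (rule sum.mono_neutral_right)
    show "\<forall>k\<in>{k. k dvd d} - {k. k dvd e}. of_int (moebius k) * \<psi> (int k) * f (e div k) = 0"
    proof
      fix k assume k: "k \<in> {k. k dvd d} - {k. k dvd e}"
      then have "\<not> coprime k q" by (auto simp: e coprime_dvd_mult_right_iff)
      then have "\<psi> (int k) = 0" using dirichlet_char_eq_0_iff[OF psi, of "int k"] by simp
      then show "of_int (moebius k) * \<psi> (int k) * f (e div k) = 0" by simp
    qed
  qed (use d in \<open>auto simp: e\<close>)
  also have "\<dots> = (\<Sum>k | k dvd e. f k * of_int (moebius (e div k)) * \<psi> (int (e div k)))"
    by (rule sum.reindex_bij_witness[of _ "\<lambda>k. e div k" "\<lambda>k. e div k"])
       (use pos in \<open>auto simp: mult_ac\<close>)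
  finally show ?thesis using pos by (simp add: de) (simp add: e)
qed

lemma dirichlet_char_minus_1_cases:
  assumes "dirichlet_char q chi"
  obtains "chi (- 1) = 1" | "chi (- 1) = - 1"
  using dirichlet_char_minus_1_square[OF assms] square_eq_1_iff by blast

theorem theorem3p6:
  fixes q1 q2 c :: nat and chi1 chi2 \<xi> :: "int \<Rightarrow> complex"
  assumes "primitive_char q1 chi1" and "nontrivial_char q1 chi1"
    and "primitive_char q2 chi2" and "nontrivial_char q2 chi2"
    and "chi1 (- 1) * chi2 (- 1) = 1"
    and "c > 0" and "q1 * q2 dvd c"
    and "dirichlet_char c \<xi>"
  shows "(\<Sum>a | a \<in> {0..<int c} \<and> coprime a (int c). dedekind_S q1 chi1 chi2 a c * \<xi> a) =
    of_nat (totient c) / (complex_of_real pi * \<i>)\<^sup>2 *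
    (if \<xi> (- 1) * chi1 (- 1) = - 1 then
       L_one (star_char c (\<lambda>n. \<xi> n * chi2 n)) *
       L_one (\<lambda>n. cnj (star_char c \<xi> n) * chi1 n) *
       g_factor q1 chi1 chi2 \<xi> c
     else 0)"
proof -
  define A where "A n = cnj (chi1 n)" for n
  define Y where "Y y = (\<Sum>n = 0..<int q1. A n * complex_of_real (B1 (of_int n / real q1 + y)))" for y
  define \<psi> where "\<psi> = star_char c \<xi>"
  define r where "r = conductor c \<xi>"
  define \<eta> where "\<eta> n = \<xi> n * chi2 n" for n
  define s where "s = conductor c \<eta>"
  define \<rho> where "\<rho> n = cnj (star_char c \<eta> n)" for n
  have A: "primitive_char q1 A" unfolding A_def by (rule primitive_char_cnj[OF assms(1)])
  have chi1: "dirichlet_char q1 chi1" and chi2: "dirichlet_char q2 chi2"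
    using assms by (auto intro: primitive_char_imp_dirichlet_char)
  note xi = assms(8) and c = assms(6)
  have q2c: "q2 dvd c" using assms(7) by (rule dvd_mult_right)
  have eta: "dirichlet_char c \<eta>" unfolding \<eta>_def by (rule dirichlet_char_times[OF xi chi2 q2c])
  have residues_1: "{0..<1} = {0 :: int}" by auto
  have psi: "primitive_char r \<psi>" "dirichlet_char r \<psi>"
    unfolding \<psi>_def r_def by (rule star_char star_char_props xi)+
  have rho: "primitive_char s \<rho>" "dirichlet_char s \<rho>"
    unfolding \<rho>_def s_def by (rule primitive_char_cnj dirichlet_char_cnj star_char star_char_props eta)+

  \<comment> \<open>\<open>P\<close> and \<open>Q\<close> are the two twisted sums. The aim is
    \<open>P d = M d * W\<close>, wherever \<open>chi2 (int (c div d))\<close> is nonzero, and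
    \<open>Q d = R d * Z\<close>: the divisor sums \<open>M\<close> and \<open>R\<close> of
    \<open>g_factor\<close> carry the dependence on \<open>d\<close>, while \<open>W\<close> and
    \<open>Z\<close> are complete sums.\<close>
  define P where "P d = (\<Sum>b\<in>unit_residues d. cnj (chi2 b) * cnj (\<psi> b) * complex_of_real (B1 (of_int b / real d)))" for d
  define Q where "Q d = (\<Sum>a\<in>unit_residues d. \<psi> a * Y (of_int a / real d))" for d
  define M where "M d = (\<Sum>k | k dvd d. of_int (moebius k) * \<rho> (int k))" for d
  define R where "R d = (\<Sum>k | k dvd d div r. chi1 (int k) * of_int (moebius (d div (k * r))) * \<psi> (int (d div (k * r))))" for d
  define Z where "Z = (\<Sum>b = 0..<int r. \<Sum>n = 0..<int q1. \<psi> b * A n * complex_of_real (B1 (of_int n / real q1 + of_int b / real r)))"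
  define W where "W = (\<Sum>b = 0..<int s. \<rho> b * complex_of_real (B1 (of_int b / real s)))"

  have S: "dedekind_S q1 chi1 chi2 a c =
      (\<Sum>j = 0..<int c. cnj (chi2 j) * complex_of_real (B1 (of_int j / real c)) * Y (of_int (a * j) / real c))" for a
    unfolding dedekind_S_def Y_def A_def sum_distrib_left by (simp add: mult_ac)
  have inner: "(\<Sum>a\<in>unit_residues c. \<xi> a * Y (of_int (a * b) / real d)) =
      (if r dvd d then of_nat (totient c) / of_nat (totient d) * cnj (\<psi> b) * Q d else 0)"
    if "d dvd c" "coprime b (int d)" for b d
  proof -
    have d: "d > 0" using that c by (auto intro: Nat.gr0I)
    have "Y (of_int a / real d) = Y (of_int a' / real d)" if "[a = a'] (mod int d)" for a a'
      unfolding Y_def using B1_frac_cong[OF d that, of "of_int n / real q1" for n]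
      by (simp only: add.commute)
    then show ?thesis
      unfolding Q_def r_def \<psi>_def using that
      by (intro sum_unit_residues_char_reduce[OF xi, where F = "\<lambda>a. Y (of_int a / real d)"])
  qed
  have "(\<Sum>a\<in>unit_residues c. dedekind_S q1 chi1 chi2 a c * \<xi> a)
      = (\<Sum>j = 0..<int c. cnj (chi2 j) * complex_of_real (B1 (of_int j / real c)) *
          (\<Sum>a\<in>unit_residues c. \<xi> a * Y (of_int (a * j) / real c)))"
    unfolding S sum_distrib_left sum_distrib_right
    by (subst sum.swap) (intro sum.cong refl, simp add: mult_ac)
  also have "\<dots> = (\<Sum>d | d dvd c. \<Sum>b\<in>unit_residues d. cnj (chi2 (int (c div d) * b)) *
        complex_of_real (B1 (of_int (int (c div d) * b) / real c)) *
          (\<Sum>a\<in>unit_residues c. \<xi> a * Y (of_int (a * (int (c div d) * b)) / real c)))"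
    by (rule sum_residues_by_gcd[OF c])
  also have "\<dots> = (\<Sum>d | d dvd c. if r dvd d then
      of_nat (totient c) * (cnj (chi2 (int (c div d))) / of_nat (totient d) * P d * Q d) else 0)"
  proof (rule sum.cong[OF refl])
    fix d assume "d \<in> {d. d dvd c}"
    then have dc: "d dvd c" by simp
    define e where "e = c div d"
    have ce: "c = e * d" using dc by (simp add: e_def)
    then have pos: "e > 0" "d > 0" using c by auto
    have frac: "of_int (a * (int e * b)) / real c = of_int (a * b) / real d"
      "of_int (int e * b) / real c = of_int b / real d" for a b
      using pos by (simp_all add: ce)
    have "(\<Sum>b\<in>unit_residues d. cnj (chi2 (int e * b)) * complex_of_real (B1 (of_int (int e * b) / real c)) *
          (\<Sum>a\<in>unit_residues c. \<xi> a * Y (of_int (a * (int e * b)) / real c)))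
        = (\<Sum>b\<in>unit_residues d. if r dvd d then of_nat (totient c) * (cnj (chi2 (int e)) / of_nat (totient d) *
          (cnj (chi2 b) * cnj (\<psi> b) * complex_of_real (B1 (of_int b / real d))) * Q d) else 0)"
    proof (rule sum.cong[OF refl])
      fix b assume "b \<in> unit_residues d"
      then have b: "coprime b (int d)" by simp
      show "cnj (chi2 (int e * b)) * complex_of_real (B1 (of_int (int e * b) / real c)) *
          (\<Sum>a\<in>unit_residues c. \<xi> a * Y (of_int (a * (int e * b)) / real c))
        = (if r dvd d then of_nat (totient c) * (cnj (chi2 (int e)) / of_nat (totient d) *
          (cnj (chi2 b) * cnj (\<psi> b) * complex_of_real (B1 (of_int b / real d))) * Q d) else 0)"
        unfolding frac inner[OF dc b] by (simp add: dirichlet_char_mult[OF chi2])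
    qed
    also have "\<dots> = (if r dvd d then
      of_nat (totient c) * (cnj (chi2 (int e)) / of_nat (totient d) * P d * Q d) else 0)"
      unfolding P_def by (simp only: sum_distrib_left sum_distrib_right split: if_split) simp
    finally show "(\<Sum>b\<in>unit_residues d. cnj (chi2 (int (c div d) * b)) *
        complex_of_real (B1 (of_int (int (c div d) * b) / real c)) *
          (\<Sum>a\<in>unit_residues c. \<xi> a * Y (of_int (a * (int (c div d) * b)) / real c)))
      = (if r dvd d then of_nat (totient c) * (cnj (chi2 (int (c div d))) / of_nat (totient d) * P d * Q d) else 0)"
      unfolding e_def .
  qed
  also have "\<dots> = (\<Sum>d | d dvd c \<and> r dvd d.
      of_nat (totient c) * (cnj (chi2 (int (c div d))) / of_nat (totient d) * P d * Q d))"
    using c by (intro sum.mono_neutral_cong_right) auto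
  also have "\<dots> = (\<Sum>d | d dvd c \<and> r dvd d.
      of_nat (totient c) * W * Z * (cnj (chi2 (int (c div d))) / of_nat (totient d) * M d * R d))"
  proof (rule sum.cong[OF refl])
    fix d assume "d \<in> {d. d dvd c \<and> r dvd d}"
    then have dc: "d dvd c" and rd: "r dvd d" by auto
    have d: "d > 0" using dc c by (auto intro: Nat.gr0I)
    have Q: "Q d = R d * Z"
    proof -
      have "Q d = (\<Sum>k | k dvd d. of_int (moebius k) * \<psi> (int k) * cnj (A (int (d div (k * r))))) * Z"
        unfolding Q_def Y_def Z_def by (rule sum_unit_residues_char_B1[OF A psi(2) rd d])
      then show ?thesis
        using sum_divisors_swap[OF psi(2) rd d, of "\<lambda>k. chi1 (int k)"] by (simp add: A_def R_def)
    qed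
    show "of_nat (totient c) * (cnj (chi2 (int (c div d))) / of_nat (totient d) * P d * Q d) =
      of_nat (totient c) * W * Z * (cnj (chi2 (int (c div d))) / of_nat (totient d) * M d * R d)"
    \<comment> \<open>A nonzero value makes \<open>c div d\<close> prime to \<open>q2\<close>, so
      \<open>q2\<close> divides \<open>d\<close> and the primitive character inducing
      \<open>\<eta>\<close> splits as a product on units modulo \<open>d\<close>.\<close>
    proof (cases "chi2 (int (c div d)) = 0")
      case False
      then have "coprime (c div d) q2"
        using dirichlet_char_eq_0_iff[OF chi2, of "int (c div d)"] by simp
      moreover have "q2 dvd (c div d) * d" using dc q2c by simp
      ultimately have q2d: "q2 dvd d" by (metis coprime_commute coprime_dvd_mult_right_iff)
      have sd: "s dvd d"
        unfolding s_def \<eta>_def by (rule star_char_times(1)[OF xi chi2 dc rd[unfolded r_def] q2d])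
      have "P d = (\<Sum>b\<in>unit_residues d. \<rho> b * complex_of_real (B1 (of_int b / real d)))"
        unfolding P_def \<rho>_def \<eta>_def \<psi>_def
        by (intro sum.cong refl)
           (simp add: star_char_times(2)[OF xi chi2 dc rd[unfolded r_def] q2d] mult_ac)
      \<comment> \<open>The trivial character modulo 1 takes the place of \<open>A\<close>; its only
        residue is 0 and its conjugate values are 1.\<close>
      also have "\<dots> = M d * W"
        using sum_unit_residues_char_B1[OF primitive_char_trivial rho(2) sd d] by (simp add: M_def W_def residues_1)
      finally show ?thesis by (simp add: Q mult_ac)
    qed simp
  qed
  also have "\<dots> = of_nat (totient c) * W * Z *
      (\<Sum>d | d dvd c \<and> r dvd d. cnj (chi2 (int (c div d))) / of_nat (totient d) * M d * R d)"
    by (rule sum_distrib_left[symmetric])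
  finally have main: "(\<Sum>a\<in>unit_residues c. dedekind_S q1 chi1 chi2 a c * \<xi> a) = of_nat (totient c) * W * Z *
      (\<Sum>d | d dvd c \<and> r dvd d. cnj (chi2 (int (c div d))) / of_nat (totient d) * M d * R d)" .

  have psi_m1: "\<psi> (- 1) = \<xi> (- 1)" unfolding \<psi>_def by (rule star_char_props(3)[OF xi, symmetric]) simp
  have A_m1: "A (- 1) = chi1 (- 1)"
    by (rule dirichlet_char_minus_1_cases[OF chi1]) (simp_all add: A_def)
  have chi2_m1: "chi2 (- 1) = chi1 (- 1)"
    using assms(5) dirichlet_char_minus_1_square[OF chi1]
    by (metis mult_cancel_left mult_zero_left zero_neq_one)
  show ?thesis
  proof (cases "\<xi> (- 1) * chi1 (- 1) = - 1")
    case False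
    have "A (- 1) * \<psi> (- 1) = 1"
      unfolding A_m1 psi_m1
      \<comment> \<open>Both values are signs, so a product different from -1 is 1.\<close>
      by (rule dirichlet_char_minus_1_cases[OF chi1]; rule dirichlet_char_minus_1_cases[OF xi])
         (use False in simp_all)
    then have "Z = 0"
      unfolding Z_def
      by (intro double_B1_sum_even psi(2) primitive_char_imp_dirichlet_char[OF A])
    then show ?thesis using main False by simp
  next
    case True
    have "A (- 1) * \<psi> (- 1) = - 1" using True by (simp add: A_m1 psi_m1 mult.commute)
    then have Z: "\<i> * pi * Z = - (gauss_sum q1 A * gauss_sum r \<psi> * L_one (\<lambda>l. cnj (\<psi> l) * chi1 l))"
      using double_B1_sum_odd[OF A psi(1)] by (simp add: Z_def A_def)
    \<comment> \<open>As \<open>chi1\<close> and \<open>chi2\<close> have equal parity,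
      \<open>\<eta>\<close> is odd exactly when the product of \<open>\<xi>\<close> and
      \<open>chi1\<close> is; hence both complete sums fall under the odd case.\<close>
    have "star_char c \<eta> (- 1) = - 1"
      using star_char_props(3)[OF eta, of "- 1"] True by (simp add: \<eta>_def chi2_m1)
    then have "1 * \<rho> (- 1) = - 1" by (simp add: \<rho>_def)
    then have W: "\<i> * pi * W = - (gauss_sum s \<rho> * L_one (star_char c \<eta>))"
      using double_B1_sum_odd[OF primitive_char_trivial rho(1)]
      by (simp add: W_def \<rho>_def gauss_sum_def[of "Suc 0"] residues_1)
    have g: "g_factor q1 chi1 chi2 \<xi> c = gauss_sum s \<rho> * gauss_sum r \<psi> * gauss_sum q1 A *
        (\<Sum>d | d dvd c \<and> r dvd d. cnj (chi2 (int (c div d))) / of_nat (totient d) * M d * R d)"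
      unfolding g_factor_def Let_def M_def R_def r_def \<psi>_def s_def \<rho>_def \<eta>_def A_def ..
    \<comment> \<open>Each complete sum brings one factor \<open>\<i> * pi\<close>, whence the
      square in the denominator; the two minus signs cancel.\<close>
    have "W * Z = ((\<i> * pi * W) * (\<i> * pi * Z)) / (complex_of_real pi * \<i>)\<^sup>2"
      by (simp add: power2_eq_square field_simps)
    then have WZ: "W * Z = L_one (star_char c \<eta>) * L_one (\<lambda>l. cnj (\<psi> l) * chi1 l) *
        (gauss_sum s \<rho> * gauss_sum r \<psi> * gauss_sum q1 A) / (complex_of_real pi * \<i>)\<^sup>2"
      unfolding W Z by (simp add: mult_ac)
    have "(\<Sum>a\<in>unit_residues c. dedekind_S q1 chi1 chi2 a c * \<xi> a) = of_nat (totient c) / (complex_of_real pi * \<i>)\<^sup>2 *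
       (L_one (star_char c \<eta>) * L_one (\<lambda>l. cnj (\<psi> l) * chi1 l) * g_factor q1 chi1 chi2 \<xi> c)"
      unfolding main g mult.assoc[of _ W Z] WZ by (simp only: times_divide_eq_left times_divide_eq_right mult_ac)
    then show ?thesis using True by (simp add: \<psi>_def \<eta>_def[abs_def])
  qed
qed

end
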